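(* Let $G=\frac1n\sum_{i=1}^nG_i$ satisfy, for some $L\in(0,+\infty)$ and all $x,y\in\mathbb{R}^p$, $$\frac1n\sum_{i=1}^n\langle G_ix-G_iy,x-y\rangle\ \ge\ \frac1L\Big[\frac1n\sum_{i=1}^n\|G_ix-G_iy\|^2\Big],$$ and let $G$ be $\sigma$-strongly quasi-monotone: there exist $x^\star\in\mathrm{zer}(G)$ and $\sigma>0$ such that $\langle Gx,x-x^\star\rangle\ge\sigma\|x-x^\star\|^2$ for all $x\in\mathbb{R}^p$. Let $\kappa:=L/\sigma$. Let $\{x^k\}$ be generated by (VFKM) with $\theta_k=\frac13$, $\gamma_k=\frac12$, $\eta_k=\frac{4\beta}3$ and $\beta=\frac{\bar\beta}{2}$, where $\bar\beta$ is defined in the context in terms of the estimator constants $\rho,\Theta,\hat\Theta$, and assume that $N^2+12\rho M\ge0$ and $2\rho<1$, with $M,N$ as in the context. Then: (a) If $\widetilde S^k$ is the loopless SVRG estimator with $b$ of exact order $n^{2/3}$ and $\mathbf{p}$ of exact order $n^{-1/3}$, then (VFKM) requires, in expectation, $\mathcal{O}\big(n+\max\{n,n^{2/3}\kappa\}\log(\frac1\epsilon)\big)$ evaluations of $G_i$ to attain $\mathbb{E}[\|x^k-x^\star\|^2]\le\epsilon^2$. (b) If $\widetilde S^k$ is the SAGA estimator with $b$ of exact order $n^{2/3}$, then (VFKM) requires, in expectation, $\mathcal{O}\big(n+\max\{n,n^{2/3}\kappa\}\log(\frac1\epsilon)\big)$ evaluations of $G_i$ to attain $\mathbb{E}[\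|x^k-x^\star\|^2]\le\epsilon^2$.
   Context: Setting. $n,p\ge1$ are integers, $[n]=\{1,\dots,n\}$, $G_i:\mathbb{R}^p\to\mathbb{R}^p$ are single-valued mappings, $Gx:=\frac1n\sum_{i=1}^nG_ix$, $\mathrm{zer}(G):=\{x: Gx=0\}$. Method (VFKM). Given (deterministic) $x^0\in\mathbb{R}^p$, set $x^{-1}:=x^0$. At each $k\ge0$ construct an estimator $\widetilde S^k$ of $S^k:=Gx^k-\gamma_kGx^{k-1}$ (with $\widetilde S^0:=S^0$), and update $x^{k+1}:=x^k+\theta_k(x^k-x^{k-1})-\eta_k\widetilde S^k$. Constants. $\Gamma:=\rho+2(\Theta+\hat\Theta)$, $M:=2(2\Gamma-1)\kappa$, $N:=3\Gamma\kappa+2(1-2\rho)$, $$\bar\beta:=\frac1\sigma\min\Big\{\frac35,\ \frac{3\rho}{2(1-2\rho)},\ \frac1{2\kappa},\ \frac{6\rho}{N+\sqrt{N^2+12\rho M}}\Big\}.$$ Loopless SVRG estimator (mini-batch size $b$, probability $\mathbf{p}\in(0,1)$). Set $w^0:=x^0$. For $k\ge1$: $w^k:=x^{k-1}$ with probability $\mathbf{p}$ and $w^k:=w^{k-1}$ with probability $1-\mathbf{p}$; draw an i.i.d. (uniform, with replacement) mini-batch $\mathcal{B}_k\subseteq[n]$ of size $b$ (Bernoulli choice and $\mathcal{B}_k$ fresh and independent); with $G_{\mathcal{B}_k}x:=\frac1b\sum_{i\in\mathcal{B}_k}G_ix$, $\widetilde S^k:=(1-\gamma_k)(Gw^k-G_{\mathcal{B}_k}w^k)+G_{\mathcal{B}_k}x^k-\gamma_kG_{\mathcal{B}_k}x^{k-1}$.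 Its constants are $\rho=\frac{\mathbf{p}}2$, $\Theta=\frac{4-6\mathbf{p}+3\mathbf{p}^2}{b\mathbf{p}}$, $\hat\Theta=\frac{2(2-3\mathbf{p}+\mathbf{p}^2)}{b\mathbf{p}}$. SAGA estimator (mini-batch size $b\le n$). Set $\widehat G_i^0:=G_ix^0$. For $k\ge1$, with fresh randomness, draw an i.i.d. (uniform, with replacement) mini-batch $\mathcal{B}_k\subseteq[n]$ of size $b$ and, independently, a uniformly random $\hat{\mathcal{B}}_k\subseteq[n]$ of size $b$ without replacement; set $\widehat G_i^k:=G_ix^{k-1}$ if $i\in\hat{\mathcal{B}}_k$, $\widehat G_i^k:=\widehat G_i^{k-1}$ otherwise; with $\widehat G_{\mathcal{B}_k}^k:=\frac1b\sum_{i\in\mathcal{B}_k}\widehat G_i^k$, $\widetilde S^k:=\frac{1-\gamma_k}{n}\sum_{i=1}^n\widehat G_i^k+[G_{\mathcal{B}_k}x^k-\gamma_kG_{\mathcal{B}_k}x^{k-1}-(1-\gamma_k)\widehat G_{\mathcal{B}_k}^k]$. Its constants are $\rho=\frac b{2n}$, $\Theta=\frac{2(n-b)(2n+b)+b^2}{nb^2}$, $\hat\Theta=\frac{2(n-b)(2n+b)}{nb^2}$. Oracle complexity counts evaluations of individual $G_i$ at a point (a full evaluation of $G$ costs $n$, needed for SVRG only when $w^k$ changes; a mini-batch evaluation costs $b$). $\mathcal{O}$ is for small $\epsilon$, with hidden constants independent of $n,\kappa,\epsilon$ (they may depend on $\|x^0-x^\star\|$). *)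

theory Defs
  imports "HOL-Probability.Probability" "HOL-Library.Landau_Symbols"
begin

section \<open>Vectors and operators\<close>

text \<open>
  The dimension \<open>p\<close> is a term rather than a type, so that the constants hidden in a complexity
  bound can be chosen uniformly in \<open>p\<close>. As in the library theory of \<open>Euclidean_space\<close>, the space
  of \<open>p\<close>-dimensional real vectors consists of the sequences that vanish at all indices \<open>\<ge> p\<close>.
\<close>

type_synonym rvec = "nat \<Rightarrow> real"

abbreviation Rspace :: "nat \<Rightarrow> rvec set" where
  "Rspace p \<equiv> topspace (Euclidean_space p)"

definition vinner :: "nat \<Rightarrow> rvec \<Rightarrow> rvec \<Rightarrow> real" where
  "vinner p x y = (\<Sum>j<p. x j * y j)"

definition vnorm :: "nat \<Rightarrow> rvec \<Rightarrow> real" where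
  "vnorm p x = L2_set x {..<p}"

definition avg :: "nat \<Rightarrow> (nat \<Rightarrow> rvec) \<Rightarrow> rvec" where
  "avg n v = (\<lambda>j. (\<Sum>i=1..n. v i j) / real n)"

definition mean_op :: "nat \<Rightarrow> (nat \<Rightarrow> rvec \<Rightarrow> rvec) \<Rightarrow> rvec \<Rightarrow> rvec" where
  "mean_op n G x = avg n (\<lambda>i. G i x)"

definition zer :: "nat \<Rightarrow> (rvec \<Rightarrow> rvec) \<Rightarrow> rvec set" where
  "zer p F = {x \<in> Rspace p. F x = (\<lambda>_. 0)}"

definition cocoercive_in_average ::
    "nat \<Rightarrow> nat \<Rightarrow> (nat \<Rightarrow> rvec \<Rightarrow> rvec) \<Rightarrow> real \<Rightarrow> bool" where
  "cocoercive_in_average p n G L \<longleftrightarrow>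
     (\<forall>x\<in>Rspace p. \<forall>y\<in>Rspace p.
        (\<Sum>i=1..n. vinner p (G i x - G i y) (x - y)) / real n
          \<ge> 1 / L * ((\<Sum>i=1..n. (vnorm p (G i x - G i y))\<^sup>2) / real n))"

definition strongly_quasi_monotone ::
    "nat \<Rightarrow> (rvec \<Rightarrow> rvec) \<Rightarrow> real \<Rightarrow> rvec \<Rightarrow> bool" where
  "strongly_quasi_monotone p F \<sigma> xs \<longleftrightarrow>
     xs \<in> zer p F \<and> (\<forall>x\<in>Rspace p. vinner p (F x) (x - xs) \<ge> \<sigma> * (vnorm p (x - xs))\<^sup>2)"

definition vfkm_problem ::
    "nat \<Rightarrow> nat \<Rightarrow> (nat \<Rightarrow> rvec \<Rightarrow> rvec) \<Rightarrow> real \<Rightarrow> real \<Rightarrow> rvec \<Rightarrow> bool" where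
  "vfkm_problem p n G L \<sigma> xs \<longleftrightarrow>
     p \<ge> 1 \<and> n \<ge> 1 \<and> (\<forall>i\<in>{1..n}. G i \<in> Rspace p \<rightarrow> Rspace p) \<and>
     L > 0 \<and> cocoercive_in_average p n G L \<and>
     \<sigma> > 0 \<and> strongly_quasi_monotone p (mean_op n G) \<sigma> xs"


section \<open>The method\<close>

text \<open>
  A (randomised) estimator with internal memory of type \<open>'s\<close> is a kernel
  \<open>est k x' x s\<close>, where \<open>x'\<close> is the iterate with index \<open>k - 1\<close>, \<open>x\<close> the iterate with index \<open>k\<close>
  and \<open>s\<close> the memory left by iteration \<open>k - 1\<close>. It yields the estimate for iteration \<open>k\<close>, the new
  memory, and the number of evaluations of individual components \<open>G i\<close> that were spent.
  The distribution \<open>vfkm \<theta> \<eta> est x0 s0 k\<close> is the joint law of the iterates \<open>k - 1\<close> and \<open>k\<close>, the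
  memory, and the number of component evaluations spent to produce iterate \<open>k\<close>. Successive calls
  of the kernel use fresh, independent randomness. Finitely supported kernels, such as those
  below, give finitely supported laws, for which all expectations exist.
\<close>

primrec vfkm ::
    "(nat \<Rightarrow> real) \<Rightarrow> (nat \<Rightarrow> real) \<Rightarrow> (nat \<Rightarrow> rvec \<Rightarrow> rvec \<Rightarrow> 's \<Rightarrow> (rvec \<times> 's \<times> nat) pmf) \<Rightarrow>
     rvec \<Rightarrow> 's \<Rightarrow> nat \<Rightarrow> (rvec \<times> rvec \<times> 's \<times> nat) pmf" where
  "vfkm \<theta> \<eta> est x0 s0 0 = return_pmf (x0, x0, s0, 0)"
| "vfkm \<theta> \<eta> est x0 s0 (Suc k) =
     bind_pmf (vfkm \<theta> \<eta> est x0 s0 k) (\<lambda>(x', x, s, c).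
       map_pmf (\<lambda>(S, s', m). (x, (\<lambda>j. x j + \<theta> k * (x j - x' j) - \<eta> k * S j), s', c + m))
         (est k x' x s))"

definition expected_sq_error :: "nat \<Rightarrow> rvec \<Rightarrow> (rvec \<times> rvec \<times> 's \<times> nat) pmf \<Rightarrow> real" where
  "expected_sq_error p xs P =
     measure_pmf.expectation P (\<lambda>(x', x, s, c). (vnorm p (x - xs))\<^sup>2)"

definition expected_evals :: "(rvec \<times> rvec \<times> 's \<times> nat) pmf \<Rightarrow> real" where
  "expected_evals P = measure_pmf.expectation P (\<lambda>(x', x, s, c). real c)"


section \<open>Estimators\<close>

definition exact_S ::
    "nat \<Rightarrow> (nat \<Rightarrow> rvec \<Rightarrow> rvec) \<Rightarrow> real \<Rightarrow> rvec \<Rightarrow> rvec \<Rightarrow> rvec" where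
  "exact_S n G g x' x = (\<lambda>j. mean_op n G x j - g * mean_op n G x' j)"

text \<open>A mini-batch drawn with replacement may repeat indices, hence it is a list.\<close>

definition minibatch :: "nat \<Rightarrow> nat \<Rightarrow> nat list pmf" where
  "minibatch n b = replicate_pmf b (pmf_of_set {1..n})"

definition batch_avg :: "nat list \<Rightarrow> (nat \<Rightarrow> rvec) \<Rightarrow> rvec" where
  "batch_avg B v = (\<lambda>j. (\<Sum>i\<leftarrow>B. v i j) / real (length B))"

text \<open>
  Loopless SVRG; the memory is the reference point \<open>w\<close>, and \<open>q\<close> is the probability of updating it.
  The evaluations are: \<open>n\<close> for iteration \<open>0\<close> (one full pass at the common starting point, which also
  gives the value of \<open>mean_op n G\<close> at the initial reference point), and afterwards a mini-batch of
  \<open>b\<close> at each of the three points, plus \<open>n\<close> whenever the reference point is updated.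
\<close>

definition svrg_estimator ::
    "nat \<Rightarrow> (nat \<Rightarrow> rvec \<Rightarrow> rvec) \<Rightarrow> (nat \<Rightarrow> real) \<Rightarrow> nat \<Rightarrow> real \<Rightarrow>
     nat \<Rightarrow> rvec \<Rightarrow> rvec \<Rightarrow> rvec \<Rightarrow> (rvec \<times> rvec \<times> nat) pmf" where
  "svrg_estimator n G \<gamma> b q k x' x w =
     (if k = 0 then return_pmf (exact_S n G (\<gamma> 0) x' x, w, n)
      else map_pmf (\<lambda>(u, B).
        let w' = (if u then x' else w) in
          ((\<lambda>j. (1 - \<gamma> k) * (mean_op n G w' j - batch_avg B (\<lambda>i. G i w') j)
                 + batch_avg B (\<lambda>i. G i x) j - \<gamma> k * batch_avg B (\<lambda>i. G i x') j),
           w', 3 * b + (if u then n else 0)))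
        (pair_pmf (bernoulli_pmf q) (minibatch n b)))"

text \<open>
  SAGA; the memory is the table \<open>H\<close> of stored component values. The evaluations are: \<open>n\<close> for
  iteration \<open>0\<close> (which also fills the initial table), and afterwards \<open>b\<close> at each of the two
  iterates plus \<open>b\<close> for the table update.
\<close>

definition saga_estimator ::
    "nat \<Rightarrow> (nat \<Rightarrow> rvec \<Rightarrow> rvec) \<Rightarrow> (nat \<Rightarrow> real) \<Rightarrow> nat \<Rightarrow>
     nat \<Rightarrow> rvec \<Rightarrow> rvec \<Rightarrow> (nat \<Rightarrow> rvec) \<Rightarrow> (rvec \<times> (nat \<Rightarrow> rvec) \<times> nat) pmf" where
  "saga_estimator n G \<gamma> b k x' x H =
     (if k = 0 then return_pmf (exact_S n G (\<gamma> 0) x' x, H, n)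
      else map_pmf (\<lambda>(B, A).
        let H' = (\<lambda>i. if i \<in> A then G i x' else H i) in
          ((\<lambda>j. (1 - \<gamma> k) * avg n H' j
                 + (batch_avg B (\<lambda>i. G i x) j - \<gamma> k * batch_avg B (\<lambda>i. G i x') j
                    - (1 - \<gamma> k) * batch_avg B H' j)),
           H', 3 * b))
        (pair_pmf (minibatch n b) (pmf_of_set {A. A \<subseteq> {1..n} \<and> card A = b})))"


section \<open>Constants\<close>

text \<open>In this section \<open>T\<close> and \<open>T'\<close> stand for the constants written as Theta and hatted Theta.\<close>

definition Gamma_const :: "real \<Rightarrow> real \<Rightarrow> real \<Rightarrow> real" where
  "Gamma_const \<rho> T T' = \<rho> + 2 * (T + T')"

definition M_const :: "real \<Rightarrow> real \<Rightarrow> real \<Rightarrow> real \<Rightarrow> real" where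
  "M_const \<rho> T T' \<kappa> = 2 * (2 * Gamma_const \<rho> T T' - 1) * \<kappa>"

definition N_const :: "real \<Rightarrow> real \<Rightarrow> real \<Rightarrow> real \<Rightarrow> real" where
  "N_const \<rho> T T' \<kappa> = 3 * Gamma_const \<rho> T T' * \<kappa> + 2 * (1 - 2 * \<rho>)"

definition beta_bar :: "real \<Rightarrow> real \<Rightarrow> real \<Rightarrow> real \<Rightarrow> real \<Rightarrow> real" where
  "beta_bar \<rho> T T' \<sigma> \<kappa> =
     (let M = M_const \<rho> T T' \<kappa>; N = N_const \<rho> T T' \<kappa> in
        1 / \<sigma> * Min {3 / 5, 3 * \<rho> / (2 * (1 - 2 * \<rho>)), 1 / (2 * \<kappa>),
                     6 * \<rho> / (N + sqrt (N\<^sup>2 + 12 * \<rho> * M))})"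

definition svrg_rho :: "real \<Rightarrow> real" where
  "svrg_rho q = q / 2"

definition svrg_T :: "nat \<Rightarrow> real \<Rightarrow> real" where
  "svrg_T b q = (4 - 6 * q + 3 * q\<^sup>2) / (real b * q)"

definition svrg_T' :: "nat \<Rightarrow> real \<Rightarrow> real" where
  "svrg_T' b q = 2 * (2 - 3 * q + q\<^sup>2) / (real b * q)"

definition saga_rho :: "nat \<Rightarrow> nat \<Rightarrow> real" where
  "saga_rho n b = real b / (2 * real n)"

definition saga_T :: "nat \<Rightarrow> nat \<Rightarrow> real" where
  "saga_T n b = (2 * (real n - real b) * (2 * real n + real b) + (real b)\<^sup>2) / (real n * (real b)\<^sup>2)"

definition saga_T' :: "nat \<Rightarrow> nat \<Rightarrow> real" where
  "saga_T' n b = 2 * (real n - real b) * (2 * real n + real b) / (real n * (real b)\<^sup>2)"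

end

theory Submission
  imports Defs
begin

text \<open>
  Both estimators draw a mini-batch against a table of reference values of the components, and
  differ only in how the table is refreshed: SVRG replaces all of it with probability \<open>q\<close>, SAGA a
  random batch of its entries. In both cases the expected mean square distance of the table from the
  component values \<open>G i xs\<close> at the solution becomes a convex combination, with weight \<open>2 \<rho>\<close> on the
  previous iterate. The locale \<open>snapshot_method\<close> isolates this mechanism.

  Write \<open>a x\<close> for the mean operator at \<open>x\<close> and \<open>P x\<close> for the mean square of \<open>G i x - G i xs\<close>. With
  \<open>\<theta> = 1/3\<close>, \<open>\<gamma> = 1/2\<close> and \<open>\<eta> = 4 \<beta> / 3\<close>, put \<open>r\<close> for half of the last increment plus
  \<open>\<beta> (a x')\<close>, where \<open>x'\<close> is the previous iterate, and \<open>u = x + r\<close>. If \<open>e\<close> is the error of the estimate,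
  one step of the method reads
    \<open>u \<leftarrow> u - \<beta> (a x) - 2 \<beta> e\<close> and \<open>r \<leftarrow> (r + \<beta> (a x) - 2 \<beta> e) / 3\<close>,
  a forward step for \<open>u\<close> evaluated at \<open>u - r\<close>. As \<open>e\<close> has conditional mean zero, it enters the
  expectation of \<open>norm (u - xs)\<^sup>2 + 9/10 (norm r)\<^sup>2\<close> only through its variance, while the cross term
  of \<open>r\<close> and \<open>a x\<close> nearly cancels and is absorbed by the shrinking of \<open>r\<close>
  (\<open>mean_step_descent\<close>). What remains to pay for everything else is \<open>2 \<beta>\<close> times the inner product of
  \<open>a x\<close> and \<open>x - xs\<close>. Co-coercivity between \<open>x\<close> and \<open>xs\<close> bounds it below by \<open>P x / L\<close>, which covers
  the terms of order \<open>\<beta>\<^sup>2\<close> and the variance, because the latter is at most \<open>1 / b\<close> times a combination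
  of \<open>P\<close> at the two iterates and the deviation of the table. A small fraction of the inner product
  is left for strong quasi-monotonicity, which gives the contraction (\<open>lyap_contracts\<close>).

  The prescribed step size makes this balance work for every batch size and gives a contraction
  factor \<open>1 - \<omega>\<close> with \<open>1 / \<omega>\<close> of order \<open>\<kappa> + 1 / \<rho>\<close>, as long as the sum of the two variance
  constants is of order \<open>\<rho>\<close> (\<open>step_size_bounds\<close>). For parameters of the stated orders this holds
  with \<open>1 / \<rho>\<close> of order \<open>n powr (1/3)\<close>, and an iteration costs of order \<open>n powr (2/3)\<close> evaluations;
  the product of iteration count and cost is the claimed bound.
\<close>

section \<open>Vectors and finitely supported expectations\<close>

lemma vnorm_sq: "(vnorm p v)\<^sup>2 = (\<Sum>j<p. (v j)\<^sup>2)"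
  by (simp add: vnorm_def L2_set_def sum_nonneg)

lemma Rspace_iff: "x \<in> Rspace p \<longleftrightarrow> (\<forall>j\<ge>p. x j = 0)"
  by (simp add: topspace_Euclidean_space)

lemma integrable_finite_pmf:
  fixes f :: "'a \<Rightarrow> real"
  shows "finite (set_pmf M) \<Longrightarrow> integrable (measure_pmf M) f"
  by (rule integrable_measure_pmf_finite)

lemma expectation_bind_finite:
  fixes h :: "'b \<Rightarrow> real"
  assumes "finite (set_pmf M)" "\<And>x. x \<in> set_pmf M \<Longrightarrow> finite (set_pmf (f x))"
  shows "measure_pmf.expectation (M \<bind> f) h =
         measure_pmf.expectation M (\<lambda>x. measure_pmf.expectation (f x) h)"
proof -
  have "measure_pmf.expectation (M \<bind> f) h =
      (\<Sum>a\<in>set_pmf M. pmf M a *\<^sub>R measure_pmf.expectation (f a) h)"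
    using assms by (intro pmf_expectation_bind) auto
  also have "\<dots> = measure_pmf.expectation M (\<lambda>x. measure_pmf.expectation (f x) h)"
    using assms(1) by (intro integral_measure_pmf[symmetric]) auto
  finally show ?thesis .
qed

lemma expectation_pair_finite:
  fixes h :: "'a \<times> 'b \<Rightarrow> real"
  assumes "finite (set_pmf M)" "finite (set_pmf N)"
  shows "measure_pmf.expectation (pair_pmf M N) h =
         measure_pmf.expectation M (\<lambda>x. measure_pmf.expectation N (\<lambda>y. h (x, y)))"
  unfolding pair_pmf_def using assms
  by (simp add: expectation_bind_finite bind_return_pmf flip: map_pmf_def)

lemma expectation_mono_finite:
  fixes f g :: "'a \<Rightarrow> real"
  assumes "finite (set_pmf M)" "\<And>x. x \<in> set_pmf M \<Longrightarrow> f x \<le> g x"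
  shows "measure_pmf.expectation M f \<le> measure_pmf.expectation M g"
  using assms
  by (intro integral_mono_AE integrable_finite_pmf) (auto simp: AE_measure_pmf_iff)

lemma expectation_cong_pmf:
  fixes f g :: "'a \<Rightarrow> real"
  assumes "\<And>x. x \<in> set_pmf M \<Longrightarrow> f x = g x"
  shows "measure_pmf.expectation M f = measure_pmf.expectation M g"
  using assms by (intro integral_cong_AE) (auto simp: AE_measure_pmf_iff)

text \<open>The bias-variance identity, for an affine image of a random vector.\<close>

lemma expectation_vnorm_sq_affine:
  fixes S :: "'a \<Rightarrow> rvec"
  assumes fin: "finite (set_pmf M)"
    and mean: "\<And>j. measure_pmf.expectation M (\<lambda>\<omega>. S \<omega> j) = m j"
  shows "measure_pmf.expectation M (\<lambda>\<omega>. (vnorm p (\<lambda>j. v j - t * S \<omega> j))\<^sup>2) =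
         (vnorm p (\<lambda>j. v j - t * m j))\<^sup>2 +
         t\<^sup>2 * measure_pmf.expectation M (\<lambda>\<omega>. (vnorm p (\<lambda>j. S \<omega> j - m j))\<^sup>2)"
proof -
  note int = integrable_finite_pmf[OF fin]
  have coord: "measure_pmf.expectation M (\<lambda>\<omega>. (v j - t * S \<omega> j)\<^sup>2) =
        (v j - t * m j)\<^sup>2 + t\<^sup>2 * measure_pmf.expectation M (\<lambda>\<omega>. (S \<omega> j - m j)\<^sup>2)" for j
  proof -
    have "(v j - t * S \<omega> j)\<^sup>2 =
        (v j - t * m j)\<^sup>2 + ((- 2 * t * (v j - t * m j)) * (S \<omega> j - m j)
          + t\<^sup>2 * (S \<omega> j - m j)\<^sup>2)" for \<omega>
      by (simp add: power2_eq_square algebra_simps)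
    moreover have "measure_pmf.expectation M (\<lambda>\<omega>. S \<omega> j - m j) = 0"
      by (simp add: Bochner_Integration.integral_diff int mean)
    ultimately show ?thesis
      by (simp only: Bochner_Integration.integral_add Bochner_Integration.integral_mult_right_zero
          int measure_pmf.prob_space_axioms lebesgue_integral_const) simp
  qed
  show ?thesis
    by (simp add: vnorm_sq Bochner_Integration.integral_sum int coord sum.distrib sum_distrib_left)
qed


section \<open>Mini-batches drawn with replacement\<close>

lemma finite_set_minibatch:
  assumes "n \<ge> 1"
  shows "finite (set_pmf (minibatch n b))"
proof -
  have "set_pmf (minibatch n b) = {xs \<in> lists {1..n}. length xs = b}"
    using assms by (simp add: minibatch_def set_replicate_pmf)
  thus ?thesis using finite_lists_length_eq[of "{1..n}" b] by (simp add: lists_eq_set Collect_conj_eq)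
qed

lemma length_minibatch: "B \<in> set_pmf (minibatch n b) \<Longrightarrow> length B = b"
  by (simp add: minibatch_def set_replicate_pmf)

lemma expectation_minibatch_Suc:
  fixes h :: "nat list \<Rightarrow> real"
  assumes "n \<ge> 1"
  shows "measure_pmf.expectation (minibatch n (Suc b)) h =
         (\<Sum>i=1..n. measure_pmf.expectation (minibatch n b) (\<lambda>B. h (i # B))) / real n"
proof -
  have fin: "finite (set_pmf (pmf_of_set {1..n}))" "{1..n} \<noteq> {}"
    using assms by auto
  have "minibatch n (Suc b) = pmf_of_set {1..n} \<bind> (\<lambda>i. map_pmf ((#) i) (minibatch n b))"
    by (simp add: minibatch_def map_pmf_def)
  hence "measure_pmf.expectation (minibatch n (Suc b)) h =
      measure_pmf.expectation (pmf_of_set {1..n})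
        (\<lambda>i. measure_pmf.expectation (minibatch n b) (\<lambda>B. h (i # B)))"
    using fin(1) finite_set_minibatch[OF assms] by (simp add: expectation_bind_finite)
  thus ?thesis using fin by (simp add: integral_pmf_of_set)
qed

lemma expectation_minibatch_sum:
  fixes g :: "nat \<Rightarrow> real"
  assumes "n \<ge> 1"
  shows "measure_pmf.expectation (minibatch n b) (\<lambda>B. \<Sum>i\<leftarrow>B. g i) =
         real b * ((\<Sum>i=1..n. g i) / real n)"
proof (induction b)
  case 0
  show ?case by (simp add: minibatch_def)
next
  case (Suc b)
  note int = integrable_finite_pmf[OF finite_set_minibatch[OF assms, of b]]
  have "measure_pmf.expectation (minibatch n b) (\<lambda>B. \<Sum>i\<leftarrow>l # B. g i) =
      g l + real b * ((\<Sum>i=1..n. g i) / real n)" for l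
    by (simp add: Suc.IH int)
  thus ?case
    using assms by (simp only: expectation_minibatch_Suc sum.distrib) (simp add: field_simps)
qed

lemma expectation_minibatch_sum_sq:
  fixes g :: "nat \<Rightarrow> real"
  assumes "n \<ge> 1" "(\<Sum>i=1..n. g i) = 0"
  shows "measure_pmf.expectation (minibatch n b) (\<lambda>B. (\<Sum>i\<leftarrow>B. g i)\<^sup>2) =
         real b * ((\<Sum>i=1..n. (g i)\<^sup>2) / real n)"
proof (induction b)
  case 0
  show ?case by (simp add: minibatch_def)
next
  case (Suc b)
  note int = integrable_finite_pmf[OF finite_set_minibatch[OF assms(1), of b]]
  have "measure_pmf.expectation (minibatch n b) (\<lambda>B. (\<Sum>i\<leftarrow>l # B. g i)\<^sup>2) =
      (g l)\<^sup>2 + real b * ((\<Sum>i=1..n. (g i)\<^sup>2) / real n)" for l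
  proof -
    have "(\<Sum>i\<leftarrow>l # B. g i)\<^sup>2 = (g l)\<^sup>2 + ((2 * g l) * (\<Sum>i\<leftarrow>B. g i) + (\<Sum>i\<leftarrow>B. g i)\<^sup>2)" for B
      by (simp add: power2_eq_square algebra_simps)
    thus ?thesis
      using expectation_minibatch_sum[OF assms(1), of b g] assms(2)
      by (simp add: Bochner_Integration.integral_add int Suc.IH)
  qed
  thus ?case
    using assms(1) by (simp only: expectation_minibatch_Suc sum.distrib) (simp add: field_simps)
qed

lemma expectation_batch_avg:
  assumes "n \<ge> 1" "b \<ge> 1"
  shows "measure_pmf.expectation (minibatch n b) (\<lambda>B. batch_avg B v j) = avg n v j"
proof -
  have "measure_pmf.expectation (minibatch n b) (\<lambda>B. batch_avg B v j) =
      measure_pmf.expectation (minibatch n b) (\<lambda>B. (\<Sum>i\<leftarrow>B. v i j) / real b)"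
    by (intro expectation_cong_pmf) (simp add: batch_avg_def length_minibatch)
  thus ?thesis using assms by (simp add: expectation_minibatch_sum avg_def)
qed

text \<open>A mean of \<open>b\<close> independent draws has \<open>1 / b\<close> of the variance of one draw, and this variance
  is at most the raw second moment.\<close>

lemma batch_avg_variance:
  assumes "n \<ge> 1" "b \<ge> 1"
  shows "measure_pmf.expectation (minibatch n b)
           (\<lambda>B. (vnorm p (\<lambda>j. batch_avg B v j - avg n v j))\<^sup>2)
         \<le> (\<Sum>i=1..n. (vnorm p (v i))\<^sup>2) / real n / real b"
proof -
  note int = integrable_finite_pmf[OF finite_set_minibatch[OF assms(1), of b]]
  have coord: "measure_pmf.expectation (minibatch n b) (\<lambda>B. (batch_avg B v j - avg n v j)\<^sup>2)
      \<le> (\<Sum>i=1..n. (v i j)\<^sup>2) / real n / real b" for j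
  proof -
    define m where "m = avg n v j"
    have m: "(\<Sum>i=1..n. v i j) = real n * m"
      using assms(1) unfolding m_def avg_def by auto
    have centred: "(\<Sum>i=1..n. v i j - m) = 0" by (simp only: sum_subtractf m) simp
    have "measure_pmf.expectation (minibatch n b) (\<lambda>B. (batch_avg B v j - m)\<^sup>2) =
        measure_pmf.expectation (minibatch n b) (\<lambda>B. (\<Sum>i\<leftarrow>B. v i j - m)\<^sup>2 / (real b)\<^sup>2)"
    proof (intro expectation_cong_pmf)
      fix B assume "B \<in> set_pmf (minibatch n b)"
      hence "length B = b" by (rule length_minibatch)
      moreover have "(\<Sum>i\<leftarrow>B. v i j - m) = (\<Sum>i\<leftarrow>B. v i j) - real (length B) * m"
        by (induction B) (auto simp: algebra_simps)
      ultimately have "batch_avg B v j - m = (\<Sum>i\<leftarrow>B. v i j - m) / real b"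
        using assms(2) by (simp add: batch_avg_def field_simps)
      thus "(batch_avg B v j - m)\<^sup>2 = (\<Sum>i\<leftarrow>B. v i j - m)\<^sup>2 / (real b)\<^sup>2"
        by (simp add: power_divide)
    qed
    also have "\<dots> = (\<Sum>i=1..n. (v i j - m)\<^sup>2) / real n / real b"
      using expectation_minibatch_sum_sq[OF assms(1) centred, of b] assms(2)
      by (simp add: power2_eq_square)
    also have "(\<Sum>i=1..n. (v i j - m)\<^sup>2) = (\<Sum>i=1..n. (v i j)\<^sup>2) - real n * m\<^sup>2"
    proof -
      have "(\<Sum>i=1..n. (v i j - m)\<^sup>2) = (\<Sum>i=1..n. (v i j)\<^sup>2 + (m\<^sup>2 - 2 * m * v i j))"
        by (intro sum.cong) (auto simp: power2_eq_square algebra_simps)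
      also have "\<dots> = (\<Sum>i=1..n. (v i j)\<^sup>2) + (real n * m\<^sup>2 - 2 * m * (\<Sum>i=1..n. v i j))"
        by (simp add: sum.distrib sum_subtractf sum_distrib_left)
      finally show ?thesis unfolding m by (simp add: power2_eq_square)
    qed
    also have "\<dots> / real n / real b \<le> (\<Sum>i=1..n. (v i j)\<^sup>2) / real n / real b"
      by (intro divide_right_mono) auto
    finally show ?thesis unfolding m_def .
  qed
  have "measure_pmf.expectation (minibatch n b)
           (\<lambda>B. (vnorm p (\<lambda>j. batch_avg B v j - avg n v j))\<^sup>2)
      = (\<Sum>j<p. measure_pmf.expectation (minibatch n b) (\<lambda>B. (batch_avg B v j - avg n v j)\<^sup>2))"
    by (simp add: vnorm_sq Bochner_Integration.integral_sum int)
  also have "\<dots> \<le> (\<Sum>j<p. (\<Sum>i=1..n. (v i j)\<^sup>2) / real n / real b)"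
    by (intro sum_mono coord)
  also have "\<dots> = (\<Sum>i=1..n. (vnorm p (v i))\<^sup>2) / real n / real b"
    unfolding vnorm_sq by (subst sum.swap) (simp add: sum_divide_distrib)
  finally show ?thesis .
qed


section \<open>Snapshot estimators and their conditional moments\<close>

definition deviation :: "nat \<Rightarrow> nat \<Rightarrow> (nat \<Rightarrow> rvec \<Rightarrow> rvec) \<Rightarrow> rvec \<Rightarrow> (nat \<Rightarrow> rvec) \<Rightarrow> real" where
  "deviation p n G xs h = (\<Sum>i=1..n. (vnorm p (h i - G i xs))\<^sup>2) / real n"

text \<open>The estimate shared by both methods, with \<open>\<gamma> = 1/2\<close>: the mini-batch samples the increments
  relative to half of the table \<open>h\<close>, and half of the exact table mean restores the expectation.\<close>

definition snapshot_S ::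
    "nat \<Rightarrow> (nat \<Rightarrow> rvec \<Rightarrow> rvec) \<Rightarrow> rvec \<Rightarrow> rvec \<Rightarrow> (nat \<Rightarrow> rvec) \<Rightarrow> nat list \<Rightarrow> rvec" where
  "snapshot_S n G x' x h B =
     (\<lambda>j. avg n h j / 2 + batch_avg B (\<lambda>i j. G i x j - G i x' j / 2 - h i j / 2) j)"

lemma deviation_nonneg: "deviation p n G xs h \<ge> 0"
  by (simp add: deviation_def sum_nonneg)

lemma batch_avg_diff:
  "batch_avg B (\<lambda>i j. u i j - v i j) j = batch_avg B u j - batch_avg B v j"
proof -
  have "(\<Sum>i\<leftarrow>B. u i j - v i j) = (\<Sum>i\<leftarrow>B. u i j) - (\<Sum>i\<leftarrow>B. v i j)"
    by (induction B) auto
  thus ?thesis by (simp add: batch_avg_def diff_divide_distrib)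
qed

lemma batch_avg_half: "batch_avg B (\<lambda>i j. u i j / 2) j = batch_avg B u j / 2"
proof -
  have "(\<Sum>i\<leftarrow>B. u i j / 2) = (\<Sum>i\<leftarrow>B. u i j) / 2"
    by (induction B) auto
  thus ?thesis unfolding batch_avg_def by (simp only: divide_divide_eq_left mult.commute)
qed

lemma snapshot_S_batch_avg:
  "snapshot_S n G x' x h B j = avg n h j / 2 +
     (batch_avg B (\<lambda>i. G i x) j - batch_avg B (\<lambda>i. G i x') j / 2 - batch_avg B h j / 2)"
  by (simp add: snapshot_S_def batch_avg_diff[where u="\<lambda>i j. G i x j - G i x' j / 2" and v="\<lambda>i j. h i j / 2"]
      batch_avg_diff[where u="\<lambda>i. G i x" and v="\<lambda>i j. G i x' j / 2"] batch_avg_half)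

lemma avg_increments:
  "avg n h j / 2 + avg n (\<lambda>i j. G i x j - G i x' j / 2 - h i j / 2) j = exact_S n G (1/2) x' x j"
  by (simp add: avg_def exact_S_def mean_op_def sum_subtractf sum_divide_distrib[symmetric]
      diff_divide_distrib)

lemma snapshot_S_mean:
  assumes "n \<ge> 1" "b \<ge> 1"
  shows "measure_pmf.expectation (minibatch n b) (\<lambda>B. snapshot_S n G x' x h B j) =
         exact_S n G (1/2) x' x j"
  unfolding snapshot_S_def using assms
  by (simp add: Bochner_Integration.integral_add integrable_finite_pmf finite_set_minibatch
      expectation_batch_avg avg_increments)

text \<open>The coefficients \<open>1\<close>, \<open>- 1/2\<close>, \<open>- 1/2\<close> of the three values in the sampled increment cancel, so each
  of them may be measured from \<open>G i xs\<close>; the weights come from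
  \<open>(s - s'/2 - t/2)\<^sup>2 \<le> 2 s\<^sup>2 + s'\<^sup>2 + t\<^sup>2\<close>.\<close>

lemma snapshot_S_variance:
  assumes "n \<ge> 1" "b \<ge> 1"
  shows "measure_pmf.expectation (minibatch n b)
           (\<lambda>B. (vnorm p (\<lambda>j. snapshot_S n G x' x h B j - exact_S n G (1/2) x' x j))\<^sup>2)
         \<le> (2 * deviation p n G xs (\<lambda>i. G i x) + deviation p n G xs (\<lambda>i. G i x')
             + deviation p n G xs h) / real b"
proof -
  define v where "v = (\<lambda>i j. G i x j - G i x' j / 2 - h i j / 2)"
  have "snapshot_S n G x' x h B j - exact_S n G (1/2) x' x j = batch_avg B v j - avg n v j" for B j
    by (simp add: snapshot_S_def v_def flip: avg_increments[of n h j G x x'])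
  hence "measure_pmf.expectation (minibatch n b)
           (\<lambda>B. (vnorm p (\<lambda>j. snapshot_S n G x' x h B j - exact_S n G (1/2) x' x j))\<^sup>2)
         \<le> (\<Sum>i=1..n. (vnorm p (v i))\<^sup>2) / real n / real b"
    using batch_avg_variance[OF assms, of p v] by simp
  also have "(\<Sum>i=1..n. (vnorm p (v i))\<^sup>2) \<le>
      (\<Sum>i=1..n. 2 * (vnorm p (G i x - G i xs))\<^sup>2 + (vnorm p (G i x' - G i xs))\<^sup>2
                 + (vnorm p (h i - G i xs))\<^sup>2)"
  proof (rule sum_mono)
    fix i
    have "(v i j)\<^sup>2 \<le> 2 * ((G i x - G i xs) j)\<^sup>2 + ((G i x' - G i xs) j)\<^sup>2 + ((h i - G i xs) j)\<^sup>2" for j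
    proof -
      have *: "(s - s' / 2 - t / 2)\<^sup>2 \<le> 2 * s\<^sup>2 + s'\<^sup>2 + t\<^sup>2" for s s' t :: real
      proof -
        have "2 * s\<^sup>2 + s'\<^sup>2 + t\<^sup>2 - (s - s' / 2 - t / 2)\<^sup>2 = (s + (s' + t) / 2)\<^sup>2 + (s' - t)\<^sup>2 / 2"
          by (simp add: power2_eq_square field_simps)
        thus ?thesis by (smt (verit) zero_le_power2 divide_nonneg_pos)
      qed
      show ?thesis
        using *[of "(G i x - G i xs) j" "(G i x' - G i xs) j" "(h i - G i xs) j"]
        by (simp add: v_def field_simps)
    qed
    thus "(vnorm p (v i))\<^sup>2 \<le> 2 * (vnorm p (G i x - G i xs))\<^sup>2 + (vnorm p (G i x' - G i xs))\<^sup>2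
                 + (vnorm p (h i - G i xs))\<^sup>2"
      unfolding vnorm_sq by (simp only: sum_distrib_left sum.distrib[symmetric] sum_mono)
  qed
  finally show ?thesis
    by (simp add: deviation_def sum.distrib sum_distrib_left[symmetric] add_divide_distrib divide_right_mono)
qed

text \<open>The locale abstracts from the way in which a table of reference values is refreshed: in
  expectation, a fraction \<open>2 \<rho>\<close> of the table is replaced by the values at the previous iterate. Both
  estimators are instances, with \<open>I\<close> the set of admissible memories and \<open>c\<close> a bound on the expected
  number of evaluations per iteration.\<close>

locale snapshot_method =
  fixes p n :: nat and G :: "nat \<Rightarrow> rvec \<Rightarrow> rvec" and L \<sigma> :: real and xs :: rvec
    and b :: nat and \<rho> c :: real
    and refresh :: "rvec \<Rightarrow> 's \<Rightarrow> ('s \<times> nat) pmf" and tab :: "'s \<Rightarrow> nat \<Rightarrow> rvec" and I :: "'s set"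
    and est :: "nat \<Rightarrow> rvec \<Rightarrow> rvec \<Rightarrow> 's \<Rightarrow> (rvec \<times> 's \<times> nat) pmf"
  assumes problem: "vfkm_problem p n G L \<sigma> xs"
    and b_ge_1: "b \<ge> 1" and rho_pos: "0 < \<rho>" and rho_less: "2 * \<rho> < 1"
    and est_0: "est 0 x' x s = return_pmf (exact_S n G (1/2) x' x, s, n)"
    and est_pos: "k \<ge> 1 \<Longrightarrow> est k x' x s =
          map_pmf (\<lambda>((s', m), B). (snapshot_S n G x' x (tab s') B, s', m))
            (pair_pmf (refresh x' s) (minibatch n b))"
    and finite_refresh: "finite (set_pmf (refresh x' s))"
    and refresh_closed: "x' \<in> Rspace p \<Longrightarrow> s \<in> I \<Longrightarrow> (s', m) \<in> set_pmf (refresh x' s) \<Longrightarrow> s' \<in> I"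
    and tab_closed: "s \<in> I \<Longrightarrow> i \<in> {1..n} \<Longrightarrow> tab s i \<in> Rspace p"
    and refresh_deviation: "x' \<in> Rspace p \<Longrightarrow> s \<in> I \<Longrightarrow>
          measure_pmf.expectation (refresh x' s) (\<lambda>(s', m). deviation p n G xs (tab s')) =
          (1 - 2 * \<rho>) * deviation p n G xs (tab s) + 2 * \<rho> * deviation p n G xs (\<lambda>i. G i x')"
    and refresh_cost: "measure_pmf.expectation (refresh x' s) (\<lambda>(s', m). real m) \<le> c"
begin

abbreviation "a x \<equiv> mean_op n G x"
abbreviation "P x \<equiv> deviation p n G xs (\<lambda>i. G i x)"
abbreviation "Q s \<equiv> deviation p n G xs (tab s)"

lemma n_ge_1: "n \<ge> 1" and L_pos: "L > 0" and \<sigma>_pos: "\<sigma> > 0"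
  and G_closed: "i \<in> {1..n} \<Longrightarrow> x \<in> Rspace p \<Longrightarrow> G i x \<in> Rspace p"
  and xs_Rspace: "xs \<in> Rspace p" and xs_zero: "a xs = (\<lambda>_. 0)"
  using problem
  by (auto simp: vfkm_problem_def strongly_quasi_monotone_def zer_def)

lemma sum_G_xs: "(\<Sum>i=1..n. G i xs j) = 0"
  using fun_cong[OF xs_zero, of j] n_ge_1 by (auto simp: mean_op_def avg_def)

lemma avg_closed: "(\<And>i. i \<in> {1..n} \<Longrightarrow> h i \<in> Rspace p) \<Longrightarrow> avg n h \<in> Rspace p"
  unfolding Rspace_iff avg_def by simp

lemma strong_quasi_monotonicity:
  "x \<in> Rspace p \<Longrightarrow> vinner p (a x) (x - xs) \<ge> \<sigma> * (vnorm p (x - xs))\<^sup>2"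
  using problem by (auto simp: vfkm_problem_def strongly_quasi_monotone_def)

text \<open>Co-coercivity is used only between a point and the solution, where the mean operator vanishes
  although the single components need not.\<close>

lemma cocoercivity_at_zero:
  assumes "x \<in> Rspace p"
  shows "vinner p (a x) (x - xs) \<ge> P x / L"
proof -
  have "(\<Sum>i=1..n. vinner p (G i x - G i xs) (x - xs)) / real n \<ge> P x / L"
    using problem assms xs_Rspace
    by (simp add: vfkm_problem_def cocoercive_in_average_def deviation_def mult.commute)
  moreover have "(\<Sum>i=1..n. vinner p (G i x - G i xs) (x - xs)) / real n = vinner p (a x) (x - xs)"
  proof -
    have "(\<Sum>i=1..n. vinner p (G i x - G i xs) (x - xs)) =
        (\<Sum>j<p. ((\<Sum>i=1..n. G i x j) - (\<Sum>i=1..n. G i xs j)) * (x - xs) j)"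
      unfolding vinner_def by (subst sum.swap) (simp add: sum_subtractf flip: sum_distrib_right)
    thus ?thesis
      unfolding sum_G_xs
      by (simp add: vinner_def mean_op_def avg_def sum_divide_distrib[where A="{..<p}"])
  qed
  ultimately show ?thesis by simp
qed

lemma mean_op_le_deviation: "(vnorm p (a x))\<^sup>2 \<le> P x"
proof -
  have "(a x j)\<^sup>2 \<le> (\<Sum>i=1..n. ((G i x - G i xs) j)\<^sup>2) / real n" for j
  proof -
    have "a x j = (\<Sum>i=1..n. (G i x - G i xs) j) / real n"
      using sum_G_xs[of j] by (simp add: mean_op_def avg_def sum_subtractf)
    hence "(a x j)\<^sup>2 = (\<Sum>i=1..n. (G i x - G i xs) j)\<^sup>2 / (real n)\<^sup>2"
      by (simp add: power_divide)
    also have "\<dots> \<le> ((\<Sum>i=1..n. ((G i x - G i xs) j)\<^sup>2) * real n) / (real n)\<^sup>2"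
      using sum_squared_le_sum_of_squares[of "\<lambda>i. (G i x - G i xs) j" "{1..n}"]
      by (intro divide_right_mono) auto
    finally show ?thesis using n_ge_1 by (simp add: power2_eq_square)
  qed
  hence "(vnorm p (a x))\<^sup>2 \<le> (\<Sum>j<p. (\<Sum>i=1..n. ((G i x - G i xs) j)\<^sup>2) / real n)"
    unfolding vnorm_sq by (rule sum_mono)
  also have "\<dots> = P x"
    unfolding deviation_def vnorm_sq by (subst sum.swap) (simp add: sum_divide_distrib)
  finally show ?thesis .
qed

lemma deviation_le_distance:
  assumes "x \<in> Rspace p"
  shows "P x \<le> L\<^sup>2 * (vnorm p (x - xs))\<^sup>2"
proof -
  have "P x / L \<le> vinner p (a x) (x - xs)" by (rule cocoercivity_at_zero[OF assms])
  also have "\<dots> \<le> (\<Sum>j<p. (a x j)\<^sup>2 / (2 * L) + L / 2 * ((x - xs) j)\<^sup>2)"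
    unfolding vinner_def
  proof (rule sum_mono)
    fix j
    have "0 \<le> (a x j - L * (x - xs) j)\<^sup>2 / (2 * L)" using L_pos by simp
    also have "\<dots> = (a x j)\<^sup>2 / (2 * L) + L / 2 * ((x - xs) j)\<^sup>2 - a x j * (x - xs) j"
      using L_pos by (simp add: power2_eq_square field_simps)
    finally show "a x j * (x - xs) j \<le> (a x j)\<^sup>2 / (2 * L) + L / 2 * ((x - xs) j)\<^sup>2" by simp
  qed
  also have "\<dots> = (vnorm p (a x))\<^sup>2 / (2 * L) + L / 2 * (vnorm p (x - xs))\<^sup>2"
    by (simp only: vnorm_sq sum.distrib sum_distrib_left sum_divide_distrib)
  also have "\<dots> \<le> P x / (2 * L) + L / 2 * (vnorm p (x - xs))\<^sup>2"
    using mean_op_le_deviation[of x] L_pos by (simp add: divide_right_mono)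
  finally have "P x / L - P x / (2 * L) \<le> L / 2 * (vnorm p (x - xs))\<^sup>2" by linarith
  moreover have "P x / L - P x / (2 * L) = P x / (2 * L)" using L_pos by (simp add: divide_simps)
  ultimately have "P x \<le> (2 * L) * (L / 2 * (vnorm p (x - xs))\<^sup>2)"
    using L_pos by (simp add: divide_le_eq mult.commute)
  thus ?thesis by (simp add: power2_eq_square)
qed

lemma finite_est: "finite (set_pmf (est k x' x s))"
  using finite_refresh finite_set_minibatch[OF n_ge_1] by (cases k) (auto simp: est_pos est_0)

lemma exact_S_closed:
  "x' \<in> Rspace p \<Longrightarrow> x \<in> Rspace p \<Longrightarrow> exact_S n G (1/2) x' x \<in> Rspace p"
  using avg_closed[of "\<lambda>i. G i x"] avg_closed[of "\<lambda>i. G i x'"] G_closed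
  unfolding exact_S_def mean_op_def Rspace_iff by simp

lemma snapshot_S_closed:
  assumes "x' \<in> Rspace p" "x \<in> Rspace p" "s \<in> I" "B \<in> set_pmf (minibatch n b)"
  shows "snapshot_S n G x' x (tab s) B \<in> Rspace p"
proof -
  have B: "set B \<subseteq> {1..n}"
    using assms(4) n_ge_1 by (auto simp: minibatch_def set_replicate_pmf)
  have "batch_avg B h j = 0" if "\<And>i. i \<in> {1..n} \<Longrightarrow> h i \<in> Rspace p" "j \<ge> p" for h j
  proof -
    have "(\<Sum>i\<leftarrow>B. h i j) = (\<Sum>i\<leftarrow>B. 0)"
      using that B by (intro arg_cong[where f=sum_list] map_cong) (auto simp: Rspace_iff)
    thus ?thesis by (simp add: batch_avg_def)
  qed
  thus ?thesis
    using assms avg_closed[of "tab s"] G_closed tab_closed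
    unfolding Rspace_iff[of "snapshot_S _ _ _ _ _ _"] snapshot_S_batch_avg
    by (simp add: Rspace_iff[of "avg _ _"])
qed

lemma est_closed:
  assumes "x' \<in> Rspace p" "x \<in> Rspace p" "s \<in> I" "(S, s', m) \<in> set_pmf (est k x' x s)"
  shows "S \<in> Rspace p \<and> s' \<in> I"
proof (cases "k \<ge> 1")
  case True
  then obtain B where "(s', m) \<in> set_pmf (refresh x' s)" "B \<in> set_pmf (minibatch n b)"
      "S = snapshot_S n G x' x (tab s') B"
    using assms(4) by (auto simp: est_pos)
  thus ?thesis using refresh_closed[OF assms(1,3)] snapshot_S_closed[OF assms(1,2)] by blast
next
  case False
  thus ?thesis using assms exact_S_closed by (auto simp: est_0 not_le)
qed

lemma expectation_est:
  fixes f :: "rvec \<Rightarrow> 's \<Rightarrow> nat \<Rightarrow> real"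
  assumes "k \<ge> 1"
  shows "measure_pmf.expectation (est k x' x s) (\<lambda>(S, s', m). f S s' m) =
         measure_pmf.expectation (refresh x' s) (\<lambda>(s', m).
           measure_pmf.expectation (minibatch n b) (\<lambda>B. f (snapshot_S n G x' x (tab s') B) s' m))"
  using finite_refresh finite_set_minibatch[OF n_ge_1]
  by (simp add: est_pos[OF assms] expectation_pair_finite case_prod_unfold)

lemma est_mean:
  "measure_pmf.expectation (est k x' x s) (\<lambda>(S, s', m). S j) = exact_S n G (1/2) x' x j"
proof (cases "k \<ge> 1")
  case True
  thus ?thesis
    using expectation_est[OF True, where f="\<lambda>S s' m. S j", of x' x s]
    by (simp add: snapshot_S_mean[OF n_ge_1 b_ge_1] case_prod_unfold)
qed (simp add: est_0 not_le)

lemma est_deviation: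
  assumes "k \<ge> 1" "x' \<in> Rspace p" "s \<in> I"
  shows "measure_pmf.expectation (est k x' x s) (\<lambda>(S, s', m). Q s') =
         (1 - 2 * \<rho>) * Q s + 2 * \<rho> * P x'"
  using refresh_deviation[OF assms(2,3)] by (simp add: expectation_est[OF assms(1)])

lemma est_variance:
  assumes "k \<ge> 1" "x' \<in> Rspace p" "s \<in> I"
  shows "measure_pmf.expectation (est k x' x s)
           (\<lambda>(S, s', m). (vnorm p (\<lambda>j. S j - exact_S n G (1/2) x' x j))\<^sup>2)
         \<le> (2 * P x + P x' + ((1 - 2 * \<rho>) * Q s + 2 * \<rho> * P x')) / real b"
proof -
  note int = integrable_finite_pmf[OF finite_refresh]
  have "measure_pmf.expectation (est k x' x s)
           (\<lambda>(S, s', m). (vnorm p (\<lambda>j. S j - exact_S n G (1/2) x' x j))\<^sup>2)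
       \<le> measure_pmf.expectation (refresh x' s)
            (\<lambda>(s', m). (2 * P x + P x' + Q s') / real b)"
    unfolding expectation_est[where f="\<lambda>S s' m. (vnorm p (\<lambda>j. S j - exact_S n G (1/2) x' x j))\<^sup>2",
        OF assms(1)]
    using snapshot_S_variance[OF n_ge_1 b_ge_1]
    by (intro expectation_mono_finite finite_refresh) (auto simp: case_prod_unfold)
  also have "\<dots> = (2 * P x + P x' + measure_pmf.expectation (refresh x' s) (\<lambda>(s', m). Q s')) / real b"
    by (simp add: case_prod_unfold int)
  finally show ?thesis by (simp add: refresh_deviation[OF assms(2,3)])
qed

lemma est_cost:
  "k \<ge> 1 \<Longrightarrow> measure_pmf.expectation (est k x' x s) (\<lambda>(S, s', m). real m) \<le> c"
  using refresh_cost by (simp add: expectation_est)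

end


section \<open>A Lyapunov function\<close>

subsection \<open>Descent of the mean step\<close>

text \<open>The descent estimate for the mean of one step: \<open>z\<close> is the error, \<open>r\<close> the momentum residual,
  \<open>g\<close> the operator value and \<open>h\<close> the mean square of the component values. The weight \<open>1/10\<close> for the residual
  leaves the coefficient \<open>-(9/5) \<beta>\<close> of \<open>r g\<close>, which
  \<open>(9/10)\<^sup>2 \<le> (79/100) (1026/1000)\<close> splits. One percent of the inner product and of \<open>r\<^sup>2\<close> is
  retained for the contraction, the rest of the inner product for \<open>h\<close>.\<close>

lemma mean_step_descent:
  fixes z r g :: rvec
  assumes "\<beta> > 0" "L > 0" "\<sigma> > 0" "0 \<le> \<omega>" "\<omega> \<le> \<beta> * \<sigma> / 200" "\<omega> \<le> 3 / 2000"
    and strong: "vinner p g z \<ge> \<sigma> * (vnorm p z)\<^sup>2"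
    and coco: "vinner p g z \<ge> h / L"
    and g_le: "(vnorm p g)\<^sup>2 \<le> h"
  shows "(vnorm p (\<lambda>j. z j + r j - \<beta> * g j))\<^sup>2 + 1/10 * (vnorm p (\<lambda>j. r j + \<beta> * g j))\<^sup>2
         \<le> (1 - \<omega>) * ((vnorm p (\<lambda>j. z j + r j))\<^sup>2 + 9/10 * (vnorm p r)\<^sup>2)
            - \<beta> * (198/100 / L - 2126/1000 * \<beta>) * h"
proof -
  let ?Z = "(vnorm p z)\<^sup>2" and ?R = "(vnorm p r)\<^sup>2" and ?A = "(vnorm p g)\<^sup>2"
    and ?U = "(vnorm p (\<lambda>j. z j + r j))\<^sup>2" and ?inn = "vinner p g z"
  have "(z j + r j - \<beta> * g j)\<^sup>2 + 1/10 * (r j + \<beta> * g j)\<^sup>2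
      \<le> (z j + r j)\<^sup>2 + 89/100 * (r j)\<^sup>2 - 2 * \<beta> * (g j * z j) + 2126/1000 * \<beta>\<^sup>2 * (g j)\<^sup>2" for j
  proof -
    define w where "w = \<beta> * g j"
    have "0 \<le> 79/100 * (r j + 90/79 * w)\<^sup>2 + (1026/1000 - 81/79) * w\<^sup>2" by simp
    also have "\<dots> = 79/100 * (r j)\<^sup>2 + 18/10 * (r j * w) + 1026/1000 * w\<^sup>2"
      by (simp add: power2_eq_square field_simps)
    also have "\<dots> = (z j + r j)\<^sup>2 + 89/100 * (r j)\<^sup>2 - 2 * (w * z j) + 2126/1000 * w\<^sup>2
        - ((z j + r j - w)\<^sup>2 + 1/10 * (r j + w)\<^sup>2)"
      by (simp add: power2_eq_square field_simps)
    finally show ?thesis by (simp add: w_def power_mult_distrib mult.assoc)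
  qed
  hence "(\<Sum>j<p. (z j + r j - \<beta> * g j)\<^sup>2 + 1/10 * (r j + \<beta> * g j)\<^sup>2)
      \<le> (\<Sum>j<p. (z j + r j)\<^sup>2 + 89/100 * (r j)\<^sup>2 - 2 * \<beta> * (g j * z j) + 2126/1000 * \<beta>\<^sup>2 * (g j)\<^sup>2)"
    by (intro sum_mono) auto
  hence step: "(vnorm p (\<lambda>j. z j + r j - \<beta> * g j))\<^sup>2 + 1/10 * (vnorm p (\<lambda>j. r j + \<beta> * g j))\<^sup>2
      \<le> ?U + 89/100 * ?R - 2 * \<beta> * ?inn + 2126/1000 * \<beta>\<^sup>2 * ?A"
    by (simp only: vnorm_sq vinner_def sum.distrib sum_subtractf sum_distrib_left)
  have "(\<Sum>j<p. (z j + r j)\<^sup>2) \<le> (\<Sum>j<p. 2 * (z j)\<^sup>2 + 2 * (r j)\<^sup>2)"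
  proof (rule sum_mono)
    fix j show "(z j + r j)\<^sup>2 \<le> 2 * (z j)\<^sup>2 + 2 * (r j)\<^sup>2"
      using zero_le_power2[of "z j - r j"] by (simp add: power2_eq_square algebra_simps)
  qed
  hence U: "?U \<le> 2 * ?Z + 2 * ?R"
    by (simp only: vnorm_sq sum.distrib sum_distrib_left)
  have "\<omega> * (?U + 9/10 * ?R) \<le> \<omega> * (2 * ?Z) + \<omega> * (29/10 * ?R)"
    using mult_left_mono[OF U \<open>0 \<le> \<omega>\<close>] by (simp add: algebra_simps)
  also have "\<dots> \<le> (\<beta> * \<sigma> / 200) * (2 * ?Z) + (3 / 2000) * (29/10 * ?R)"
    using assms(5,6) by (intro add_mono mult_right_mono) auto
  also have "\<dots> \<le> \<beta> / 50 * (\<sigma> * ?Z) + 1 / 100 * ?R"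
  proof -
    have "0 \<le> \<beta> * \<sigma> * ?Z" "0 \<le> ?R" using assms(1,3) by auto
    moreover have "\<beta> * \<sigma> / 200 * (2 * ?Z) = 1/100 * (\<beta> * \<sigma> * ?Z)"
      "\<beta> / 50 * (\<sigma> * ?Z) = 1/50 * (\<beta> * \<sigma> * ?Z)" by simp_all
    ultimately show ?thesis by linarith
  qed
  also have "\<dots> \<le> \<beta> / 50 * ?inn + 1 / 100 * ?R"
    using strong assms(1) by simp
  finally have contraction: "\<omega> * (?U + 9/10 * ?R) \<le> \<beta> / 50 * ?inn + 1 / 100 * ?R" .
  have "198/100 * \<beta> * (h / L) \<le> 198/100 * \<beta> * ?inn"
    using coco assms(1) by (intro mult_left_mono) auto
  moreover have "2126/1000 * \<beta>\<^sup>2 * ?A \<le> 2126/1000 * \<beta>\<^sup>2 * h"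
    using g_le by (intro mult_left_mono) auto
  ultimately have "?U + 89/100 * ?R - 2 * \<beta> * ?inn + 2126/1000 * \<beta>\<^sup>2 * ?A \<le>
      ?U + 9/10 * ?R - \<omega> * (?U + 9/10 * ?R) - 198/100 * \<beta> * (h / L) + 2126/1000 * \<beta>\<^sup>2 * h"
    using contraction by linarith
  also have "\<dots> = (1 - \<omega>) * (?U + 9/10 * ?R) - \<beta> * (198/100 / L - 2126/1000 * \<beta>) * h"
    using assms(2) by (simp add: field_simps power2_eq_square)
  finally show ?thesis using step by linarith
qed

subsection \<open>Contraction in expectation\<close>

text \<open>The last condition keeps the deviation at the current iterate under control: its coefficient
  \<open>2126/1000 = (1 + 1/10) + 1026/1000\<close> comes from the mean step, and
  \<open>17644/1000 = 22/5 \<cdot> 4010/1000\<close> collects its total share of the variance,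
  \<open>4\<close> up to the margins in the weights below.\<close>

locale stable_snapshot_method = snapshot_method +
  fixes \<beta> \<omega> :: real
  assumes beta_pos: "\<beta> > 0" and omega_pos: "\<omega> > 0"
    and omega_le_beta: "\<omega> \<le> \<beta> * \<sigma> / 200" and omega_le_rho: "\<omega> \<le> \<rho> / 200"
    and beta_sigma: "\<beta> * \<sigma> \<le> 3 / 10" and beta_L: "\<beta> * L \<le> 1 / 4"
    and beta_L_b: "2126/1000 * (\<beta> * L) + 17644/1000 * (\<beta> * L / real b) \<le> 198/100"
begin

text \<open>The weight of the conditional variance in the expected Lyapunov function: \<open>(2 \<beta>)\<^sup>2\<close> from the
  lead and \<open>9/10 (2 \<beta> / 3)\<^sup>2\<close> from the residual, times \<open>1 / b\<close>.\<close>

definition "\<epsilon> = 22/5 * \<beta>\<^sup>2 / real b"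

text \<open>The weight of the table makes what it loses in one refresh pay for the variance that it causes,
  with a margin of half a percent; the weight of the previous iterate covers its share of the
  variance and of the refreshed table.\<close>

definition "tab_weight = (201/200 / (2 * \<rho>) - 1) * \<epsilon>"
definition "prev_weight = 201/100 * \<epsilon>"

definition "resid x' x = (\<lambda>j. (x j - x' j) / 2 + \<beta> * a x' j)"
definition "lead_error x' x = (\<lambda>j. x j + resid x' x j - xs j)"

definition "lyap x' x s =
  (vnorm p (lead_error x' x))\<^sup>2 + 9/10 * (vnorm p (resid x' x))\<^sup>2 + prev_weight * P x' + tab_weight * Q s"

abbreviation "next x' x S \<equiv> (\<lambda>j. x j + 1/3 * (x j - x' j) - 4 * \<beta> / 3 * S j)"

lemma eps_pos: "\<epsilon> > 0"
  using beta_pos b_ge_1 by (simp add: \<epsilon>_def)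

lemma tab_weight_nonneg: "tab_weight \<ge> 0"
proof -
  have "1 \<le> 201/200 / (2 * \<rho>)" using rho_pos rho_less by (simp add: field_simps)
  thus ?thesis using eps_pos by (simp add: tab_weight_def)
qed

lemma prev_weight_nonneg: "prev_weight \<ge> 0"
  using eps_pos by (simp add: prev_weight_def)

lemma omega_small: "\<omega> \<le> 3 / 2000"
  using omega_le_beta beta_sigma by simp

lemma deviation_budget: "4010/1000 * \<epsilon> * P x \<le> \<beta> * (198/100 / L - 2126/1000 * \<beta>) * P x"
proof (rule mult_right_mono[OF _ deviation_nonneg])
  have "\<beta> / L * (2126/1000 * (\<beta> * L) + 17644/1000 * (\<beta> * L / real b)) \<le> \<beta> / L * (198/100)"
    using beta_L_b beta_pos L_pos by (intro mult_left_mono) auto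
  also have "\<beta> / L * (2126/1000 * (\<beta> * L) + 17644/1000 * (\<beta> * L / real b)) =
      2126/1000 * \<beta>\<^sup>2 + 4010/1000 * \<epsilon>"
    using L_pos by (simp add: \<epsilon>_def power2_eq_square field_simps)
  finally show "4010/1000 * \<epsilon> \<le> \<beta> * (198/100 / L - 2126/1000 * \<beta>)"
    by (simp add: power2_eq_square algebra_simps)
qed

lemma mean_part_descent:
  assumes "x \<in> Rspace p"
  shows "(vnorm p (\<lambda>j. lead_error x' x j - \<beta> * a x j))\<^sup>2
           + 1/10 * (vnorm p (\<lambda>j. resid x' x j + \<beta> * a x j))\<^sup>2
         \<le> (1 - \<omega>) * ((vnorm p (lead_error x' x))\<^sup>2 + 9/10 * (vnorm p (resid x' x))\<^sup>2)
            - 4010/1000 * \<epsilon> * P x"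
proof -
  have "lead_error x' x = (\<lambda>j. (x - xs) j + resid x' x j)"
    by (simp add: lead_error_def fun_eq_iff)
  thus ?thesis
    using mean_step_descent[OF beta_pos L_pos \<sigma>_pos less_imp_le[OF omega_pos] omega_le_beta omega_small
        strong_quasi_monotonicity[OF assms] cocoercivity_at_zero[OF assms] mean_op_le_deviation,
        of "resid x' x"] deviation_budget[of x]
    by simp
qed

text \<open>In terms of the error \<open>e\<close> of the estimate, the lead moves by \<open>- \<beta> (a x + 2 e)\<close> and the
  residual becomes \<open>(resid x' x + \<beta> (a x - 2 e)) / 3\<close>; both are affine in the estimate.\<close>

lemma expected_lyap_next:
  "measure_pmf.expectation (est k x' x s) (\<lambda>(S, s', m). lyap x (next x' x S) s') =
     (vnorm p (\<lambda>j. lead_error x' x j - \<beta> * a x j))\<^sup>2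
     + 1/10 * (vnorm p (\<lambda>j. resid x' x j + \<beta> * a x j))\<^sup>2
     + 22/5 * \<beta>\<^sup>2 * measure_pmf.expectation (est k x' x s)
           (\<lambda>(S, s', m). (vnorm p (\<lambda>j. S j - exact_S n G (1/2) x' x j))\<^sup>2)
     + prev_weight * P x
     + tab_weight * measure_pmf.expectation (est k x' x s) (\<lambda>(S, s', m). Q s')"
proof -
  let ?M = "est k x' x s" and ?m = "exact_S n G (1/2) x' x"
  note int = integrable_finite_pmf[OF finite_est]
  define v where "v = (\<lambda>j. lead_error x' x j + \<beta> * a x j - \<beta> * a x' j)"
  define w where "w = (\<lambda>j. (x j - x' j) / 6 + \<beta> * a x j)"
  have mean: "measure_pmf.expectation ?M (\<lambda>\<zeta>. fst \<zeta> j) = ?m j" for j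
    using est_mean[of k x' x s j] by (simp add: case_prod_unfold)
  have lead: "lead_error x (next x' x S) = (\<lambda>j. v j - 2 * \<beta> * S j)" for S
    by (simp add: lead_error_def resid_def v_def fun_eq_iff field_simps)
  have res: "resid x (next x' x S) = (\<lambda>j. w j - 2 * \<beta> / 3 * S j)" for S
    by (simp add: resid_def w_def fun_eq_iff field_simps)
  let ?D = "measure_pmf.expectation ?M (\<lambda>\<zeta>. (vnorm p (\<lambda>j. fst \<zeta> j - ?m j))\<^sup>2)"
  have "measure_pmf.expectation ?M (\<lambda>\<zeta>. lyap x (next x' x (fst \<zeta>)) (fst (snd \<zeta>))) =
      ((vnorm p (\<lambda>j. v j - 2 * \<beta> * ?m j))\<^sup>2 + (2 * \<beta>)\<^sup>2 * ?D)
      + 9/10 * ((vnorm p (\<lambda>j. w j - 2 * \<beta> / 3 * ?m j))\<^sup>2 + (2 * \<beta> / 3)\<^sup>2 * ?D)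
      + prev_weight * P x + tab_weight * measure_pmf.expectation ?M (\<lambda>\<zeta>. Q (fst (snd \<zeta>)))"
    unfolding lyap_def lead res
    by (simp only: Bochner_Integration.integral_add Bochner_Integration.integral_mult_right_zero int
        expectation_vnorm_sq_affine[OF finite_est mean]) simp
  moreover have "(\<lambda>j. v j - 2 * \<beta> * ?m j) = (\<lambda>j. lead_error x' x j - \<beta> * a x j)"
    by (simp add: v_def exact_S_def fun_eq_iff field_simps)
  moreover have "(vnorm p (\<lambda>j. w j - 2 * \<beta> / 3 * ?m j))\<^sup>2 =
      1/9 * (vnorm p (\<lambda>j. resid x' x j + \<beta> * a x j))\<^sup>2"
  proof -
    have "w j - 2 * \<beta> / 3 * ?m j = (resid x' x j + \<beta> * a x j) / 3" for j
      by (simp add: w_def exact_S_def resid_def field_simps)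
    thus ?thesis by (simp only: vnorm_sq power_divide sum_divide_distrib[symmetric]) simp
  qed
  ultimately show ?thesis
    by (simp add: case_prod_unfold power2_eq_square field_simps)
qed

text \<open>The variance distributes over the deviations at \<open>x\<close>, at \<open>x'\<close> and of the table. The table part is
  paid by the refresh, the part at \<open>x'\<close> by the weight of the previous iterate, and the part at \<open>x\<close>,
  together with the new weight of \<open>P x\<close>, by the mean step.\<close>

lemma lyap_contracts:
  assumes "k \<ge> 1" "x' \<in> Rspace p" "x \<in> Rspace p" "s \<in> I"
  shows "measure_pmf.expectation (est k x' x s) (\<lambda>(S, s', m). lyap x (next x' x S) s')
         \<le> (1 - \<omega>) * lyap x' x s"
proof -
  let ?F = "(1 - 2 * \<rho>) * Q s + 2 * \<rho> * P x'"
  let ?E = "(vnorm p (lead_error x' x))\<^sup>2 + 9/10 * (vnorm p (resid x' x))\<^sup>2"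
  have variance: "22/5 * \<beta>\<^sup>2 * measure_pmf.expectation (est k x' x s)
      (\<lambda>(S, s', m). (vnorm p (\<lambda>j. S j - exact_S n G (1/2) x' x j))\<^sup>2) \<le> \<epsilon> * (2 * P x + P x' + ?F)"
    using mult_left_mono[OF est_variance[OF assms(1,2,4), of x], of "22/5 * \<beta>\<^sup>2"]
    by (simp add: \<epsilon>_def)
  have both: "tab_weight + \<epsilon> = 201/200 * \<epsilon> / (2 * \<rho>)"
    using rho_pos by (simp add: tab_weight_def field_simps)
  have table: "(tab_weight + \<epsilon>) * ?F \<le> (1 - \<omega>) * tab_weight * Q s + 201/200 * \<epsilon> * P x'"
  proof -
    have "(tab_weight + \<epsilon>) * ?F = (tab_weight - \<epsilon> / 200) * Q s + 201/200 * \<epsilon> * P x'"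
      unfolding both using rho_pos by (simp add: tab_weight_def field_simps)
    moreover have "\<omega> * tab_weight \<le> \<epsilon> / 200"
    proof -
      have "\<omega> * tab_weight \<le> \<rho> / 200 * (201/200 * \<epsilon> / (2 * \<rho>))"
        using omega_le_rho rho_pos both eps_pos tab_weight_nonneg by (intro mult_mono) auto
      also have "\<dots> = 201/80000 * \<epsilon>" using rho_pos by simp
      finally show ?thesis using eps_pos by simp
    qed
    hence "(tab_weight - \<epsilon> / 200) * Q s \<le> (1 - \<omega>) * tab_weight * Q s"
      by (intro mult_right_mono deviation_nonneg) (simp add: algebra_simps)
    ultimately show ?thesis by simp
  qed
  have prev: "(\<epsilon> + 201/200 * \<epsilon>) * P x' \<le> (1 - \<omega>) * prev_weight * P x'"
  proof (rule mult_right_mono[OF _ deviation_nonneg])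
    have "\<omega> * prev_weight \<le> 3 / 2000 * prev_weight"
      using omega_small prev_weight_nonneg by (rule mult_right_mono)
    moreover have "(1 - \<omega>) * prev_weight = prev_weight - \<omega> * prev_weight"
      by (simp add: algebra_simps)
    ultimately show "\<epsilon> + 201/200 * \<epsilon> \<le> (1 - \<omega>) * prev_weight"
      using eps_pos prev_weight_def by linarith
  qed
  have "measure_pmf.expectation (est k x' x s) (\<lambda>(S, s', m). lyap x (next x' x S) s')
      \<le> (1 - \<omega>) * ?E - 4010/1000 * \<epsilon> * P x + \<epsilon> * (2 * P x + P x' + ?F) + prev_weight * P x
         + tab_weight * ?F"
    unfolding expected_lyap_next est_deviation[OF assms(1,2,4)]
    using variance mean_part_descent[OF assms(3), of x'] by linarith
  also have "\<dots> = (1 - \<omega>) * ?E + \<epsilon> * P x' + (tab_weight + \<epsilon>) * ?F"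
    by (simp add: prev_weight_def algebra_simps)
  also have "\<dots> \<le> (1 - \<omega>) * ?E + (1 - \<omega>) * prev_weight * P x' + (1 - \<omega>) * tab_weight * Q s"
    using table prev by (simp add: algebra_simps)
  also have "\<dots> = (1 - \<omega>) * lyap x' x s"
    by (simp add: lyap_def algebra_simps)
  finally show ?thesis .
qed

text \<open>At iteration \<open>0\<close> the estimate is exact, but the table is not refreshed and hence its weight does
  not shrink.\<close>

lemma lyap_initial_step:
  assumes "x \<in> Rspace p"
  shows "measure_pmf.expectation (est 0 x x s) (\<lambda>(S, s', m). lyap x (next x x S) s') \<le> lyap x x s"
proof -
  let ?E = "(vnorm p (lead_error x x))\<^sup>2 + 9/10 * (vnorm p (resid x x))\<^sup>2"
  have "(1 - \<omega>) * ?E \<le> ?E"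
    using omega_pos mult_right_mono[of "1 - \<omega>" 1 ?E] by simp
  moreover have "0 \<le> \<epsilon> * P x"
    using eps_pos by (simp add: deviation_nonneg)
  moreover have "measure_pmf.expectation (est 0 x x s) (\<lambda>(S, s', m). Q s') = Q s"
    "measure_pmf.expectation (est 0 x x s)
      (\<lambda>(S, s', m). (vnorm p (\<lambda>j. S j - exact_S n G (1/2) x x j))\<^sup>2) = 0"
    by (simp_all add: est_0 vnorm_sq)
  moreover have "lyap x x s = ?E + prev_weight * P x + tab_weight * Q s"
    by (simp add: lyap_def)
  ultimately show ?thesis
    unfolding expected_lyap_next using mean_part_descent[OF assms, of x] by simp
qed

lemma error_le_lyap: "(vnorm p (x - xs))\<^sup>2 \<le> 3 * lyap x' x s"
proof -
  have "(\<Sum>j<p. ((x - xs) j)\<^sup>2) \<le> (\<Sum>j<p. 3 * (lead_error x' x j)\<^sup>2 + 27/10 * (resid x' x j)\<^sup>2)"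
  proof (rule sum_mono)
    fix j
    have "(x - xs) j = lead_error x' x j - resid x' x j" by (simp add: lead_error_def)
    moreover have "(u - t)\<^sup>2 \<le> 3 * u\<^sup>2 + 27/10 * t\<^sup>2" for u t :: real
      using zero_le_power2[of "u + t"] zero_le_power2[of u] zero_le_power2[of t]
      by (simp only: power2_diff power2_sum)
    ultimately show "((x - xs) j)\<^sup>2 \<le> 3 * (lead_error x' x j)\<^sup>2 + 27/10 * (resid x' x j)\<^sup>2" by simp
  qed
  hence "(vnorm p (x - xs))\<^sup>2 \<le> 3 * (vnorm p (lead_error x' x))\<^sup>2 + 27/10 * (vnorm p (resid x' x))\<^sup>2"
    by (simp only: vnorm_sq sum.distrib sum_distrib_left)
  moreover have "prev_weight * P x' \<ge> 0" "tab_weight * Q s \<ge> 0"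
    using prev_weight_nonneg tab_weight_nonneg deviation_nonneg by auto
  ultimately show ?thesis by (simp add: lyap_def)
qed

text \<open>The deviations at the start are at most \<open>L\<^sup>2\<close> times the squared distance, and
  \<open>\<beta> L \<le> 1/4\<close>; only the table weight, of order \<open>\<beta>\<^sup>2 / (b \<rho>)\<close>, depends on the estimator.\<close>

lemma lyap_initial:
  assumes "x \<in> Rspace p" "Q s = P x"
  shows "lyap x x s \<le> (3 + 1 / (real b * \<rho>)) * (vnorm p (x - xs))\<^sup>2"
proof -
  let ?D = "(vnorm p (x - xs))\<^sup>2"
  have "(\<beta> * L)\<^sup>2 \<le> (1/4)\<^sup>2"
    using beta_L beta_pos L_pos by (intro power_mono) auto
  hence "\<beta>\<^sup>2 * L\<^sup>2 * ?D \<le> 1/16 * ?D"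
    by (intro mult_right_mono) (auto simp: power_mult_distrib power_one_over)
  moreover have "\<beta>\<^sup>2 * P x \<le> \<beta>\<^sup>2 * (L\<^sup>2 * ?D)"
    using deviation_le_distance[OF assms(1)] by (intro mult_left_mono) auto
  ultimately have bP: "\<beta>\<^sup>2 * P x \<le> 1/16 * ?D" by (simp add: mult.assoc)
  have resid: "(vnorm p (resid x x))\<^sup>2 \<le> \<beta>\<^sup>2 * P x"
    using mult_left_mono[OF mean_op_le_deviation[of x], of "\<beta>\<^sup>2"]
    by (simp add: resid_def vnorm_sq power_mult_distrib sum_distrib_left)
  have "(\<Sum>j<p. (lead_error x x j)\<^sup>2) \<le> (\<Sum>j<p. 2 * ((x - xs) j)\<^sup>2 + 2 * (resid x x j)\<^sup>2)"
  proof (rule sum_mono)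
    fix j
    have "lead_error x x j = (x - xs) j + resid x x j" by (simp add: lead_error_def)
    moreover have "(u + t)\<^sup>2 \<le> 2 * u\<^sup>2 + 2 * t\<^sup>2" for u t :: real
      using zero_le_power2[of "u - t"] by (simp only: power2_diff power2_sum)
    ultimately show "(lead_error x x j)\<^sup>2 \<le> 2 * ((x - xs) j)\<^sup>2 + 2 * (resid x x j)\<^sup>2" by simp
  qed
  hence lead: "(vnorm p (lead_error x x))\<^sup>2 \<le> 2 * ?D + 2 * (vnorm p (resid x x))\<^sup>2"
    by (simp only: vnorm_sq sum.distrib sum_distrib_left)
  have "prev_weight + tab_weight \<le> (5 + 3 / (real b * \<rho>)) * \<beta>\<^sup>2"
  proof -
    have "prev_weight + tab_weight = (101/100 * (22/5) / real b + 201/400 * (22/5) / (real b * \<rho>)) * \<beta>\<^sup>2"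
      using rho_pos b_ge_1 by (simp add: prev_weight_def tab_weight_def \<epsilon>_def field_simps)
    also have "\<dots> \<le> (5 + 3 / (real b * \<rho>)) * \<beta>\<^sup>2"
      using rho_pos b_ge_1 by (intro mult_right_mono add_mono divide_right_mono) (auto simp: divide_le_eq)
    finally show ?thesis .
  qed
  from mult_right_mono[OF this deviation_nonneg]
  have "(prev_weight + tab_weight) * P x \<le> (5 + 3 / (real b * \<rho>)) * (\<beta>\<^sup>2 * P x)"
    by (simp only: mult.assoc)
  also have "\<dots> \<le> (5 + 3 / (real b * \<rho>)) * (1/16 * ?D)"
    using bP rho_pos by (intro mult_left_mono) auto
  finally have weights: "(prev_weight + tab_weight) * P x \<le> (5/16 + 3/16 / (real b * \<rho>)) * ?D"
    by (simp add: algebra_simps)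
  have "lyap x x s \<le> 2 * ?D + 29/10 * (\<beta>\<^sup>2 * P x) + (prev_weight + tab_weight) * P x"
    using lead resid by (simp add: lyap_def assms(2) algebra_simps)
  also have "\<dots> \<le> 2 * ?D + 29/160 * ?D + (5/16 + 3/16 / (real b * \<rho>)) * ?D"
    using bP weights by simp
  also have "\<dots> = (2 + 29/160 + 5/16 + 3/16 / (real b * \<rho>)) * ?D"
    by (simp add: algebra_simps)
  also have "\<dots> \<le> (3 + 1 / (real b * \<rho>)) * ?D"
    using rho_pos by (intro mult_right_mono add_mono divide_right_mono) auto
  finally show ?thesis .
qed

end


section \<open>Linear convergence and expected cost\<close>

context stable_snapshot_method
begin

abbreviation "law x0 s0 \<equiv> vfkm (\<lambda>_. 1/3) (\<lambda>_. 4 * \<beta> / 3) est x0 s0"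

lemma finite_law: "finite (set_pmf (law x0 s0 k))"
proof (induction k)
  case (Suc k)
  thus ?case using finite_est by (auto simp: case_prod_unfold)
qed simp

lemma expectation_law_Suc:
  fixes f :: "rvec \<Rightarrow> rvec \<Rightarrow> _ \<Rightarrow> nat \<Rightarrow> real"
  shows "measure_pmf.expectation (law x0 s0 (Suc k)) (\<lambda>(x', x, s, m). f x' x s m) =
         measure_pmf.expectation (law x0 s0 k) (\<lambda>(x', x, s, m).
           measure_pmf.expectation (est k x' x s) (\<lambda>(S, s', m'). f x (next x' x S) s' (m + m')))"
  unfolding vfkm.simps case_prod_unfold
  by (subst expectation_bind_finite) (auto simp: finite_law finite_est case_prod_unfold)

lemma law_closed:
  assumes "x0 \<in> Rspace p" "s0 \<in> I" "(x', x, s, m) \<in> set_pmf (law x0 s0 k)"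
  shows "x' \<in> Rspace p \<and> x \<in> Rspace p \<and> s \<in> I"
  using assms(3)
proof (induction k arbitrary: x' x s m)
  case 0
  thus ?case using assms by simp
next
  case (Suc k)
  then obtain y s' l S m'' where prev: "(y, x', s', l) \<in> set_pmf (law x0 s0 k)"
    "(S, s, m'') \<in> set_pmf (est k y x' s')"
    and x: "x = next y x' S"
    by (fastforce simp: case_prod_unfold)
  have IH: "y \<in> Rspace p \<and> x' \<in> Rspace p \<and> s' \<in> I"
    by (rule Suc.IH[OF prev(1)])
  hence "S \<in> Rspace p \<and> s \<in> I"
    using est_closed[of y x' s'] prev(2) by blast
  thus ?case using IH by (simp add: x Rspace_iff)
qed

lemma lyap_linear_convergence:
  assumes "x0 \<in> Rspace p" "s0 \<in> I"
  shows "measure_pmf.expectation (law x0 s0 (Suc k)) (\<lambda>(x', x, s, m). lyap x' x s)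
         \<le> (1 - \<omega>) ^ k * lyap x0 x0 s0"
proof (induction k)
  case 0
  show ?case
    unfolding expectation_law_Suc using lyap_initial_step[OF assms(1), of s0] by simp
next
  case (Suc k)
  have "measure_pmf.expectation (law x0 s0 (Suc (Suc k))) (\<lambda>(x', x, s, m). lyap x' x s)
      \<le> measure_pmf.expectation (law x0 s0 (Suc k)) (\<lambda>(x', x, s, m). (1 - \<omega>) * lyap x' x s)"
    unfolding expectation_law_Suc[of _ _ "Suc k"]
  proof (intro expectation_mono_finite finite_law, clarify)
    fix x' x s m assume "(x', x, s, m) \<in> set_pmf (law x0 s0 (Suc k))"
    from law_closed[OF assms this]
    show "measure_pmf.expectation (est (Suc k) x' x s) (\<lambda>(S, s', m'). lyap x (next x' x S) s')
        \<le> (1 - \<omega>) * lyap x' x s"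
      by (intro lyap_contracts) auto
  qed
  also have "\<dots> = (1 - \<omega>) *
      measure_pmf.expectation (law x0 s0 (Suc k)) (\<lambda>(x', x, s, m). lyap x' x s)"
    by (simp only: case_prod_unfold Bochner_Integration.integral_mult_right_zero)
  also have "\<dots> \<le> (1 - \<omega>) * ((1 - \<omega>) ^ k * lyap x0 x0 s0)"
    using omega_small by (intro mult_left_mono Suc.IH) auto
  finally show ?case by (simp add: mult.assoc)
qed

lemma error_linear_convergence:
  assumes "x0 \<in> Rspace p" "s0 \<in> I" "Q s0 = P x0"
  shows "expected_sq_error p xs (law x0 s0 (Suc k))
         \<le> 3 * (3 + 1 / (real b * \<rho>)) * (vnorm p (x0 - xs))\<^sup>2 * (1 - \<omega>) ^ k"
proof -
  have "expected_sq_error p xs (law x0 s0 (Suc k))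
      \<le> measure_pmf.expectation (law x0 s0 (Suc k)) (\<lambda>(x', x, s, m). 3 * lyap x' x s)"
    unfolding expected_sq_error_def
    by (intro expectation_mono_finite finite_law) (auto simp: error_le_lyap)
  also have "\<dots> = 3 * measure_pmf.expectation (law x0 s0 (Suc k)) (\<lambda>(x', x, s, m). lyap x' x s)"
    by (simp only: case_prod_unfold Bochner_Integration.integral_mult_right_zero)
  also have "\<dots> \<le> 3 * ((1 - \<omega>) ^ k * lyap x0 x0 s0)"
    using lyap_linear_convergence[OF assms(1,2), of k] by (rule mult_left_mono) simp
  also have "\<dots> \<le> 3 * ((1 - \<omega>) ^ k * ((3 + 1 / (real b * \<rho>)) * (vnorm p (x0 - xs))\<^sup>2))"
    using lyap_initial[OF assms(1,3)] omega_small by (intro mult_left_mono) auto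
  finally show ?thesis by (simp only: mult_ac)
qed

lemma expected_evals_le: "expected_evals (law x0 s0 (Suc k)) \<le> real n + real k * c"
proof (induction k)
  case 0
  show ?case
    unfolding expected_evals_def expectation_law_Suc by (simp add: est_0)
next
  case (Suc k)
  have "expected_evals (law x0 s0 (Suc (Suc k))) \<le>
      measure_pmf.expectation (law x0 s0 (Suc k)) (\<lambda>(x', x, s, m). real m + c)"
    unfolding expected_evals_def expectation_law_Suc[of _ _ "Suc k"]
  proof (intro expectation_mono_finite finite_law, clarify)
    fix x' x s m
    show "measure_pmf.expectation (est (Suc k) x' x s) (\<lambda>(S, s', m'). real (m + m')) \<le> real m + c"
      using est_cost[of "Suc k" x' x s]
      by (simp add: case_prod_unfold integrable_finite_pmf finite_est)
  qed
  also have "\<dots> = expected_evals (law x0 s0 (Suc k)) + c"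
    by (simp add: expected_evals_def case_prod_unfold integrable_finite_pmf[OF finite_law] del: vfkm.simps)
  finally show ?case using Suc.IH by (simp add: algebra_simps)
qed

end


section \<open>The step size\<close>

text \<open>The conditions of \<open>stable_snapshot_method\<close> hold for the prescribed step size. For \<open>b \<ge> 4\<close> the
  bound \<open>\<beta> L \<le> 1/4\<close> suffices. For smaller batches the last term of the minimum is needed; as the
  variance constants sum to at least \<open>1 / b\<close>, it gives \<open>\<beta> L \<le> b / (2 b + 8)\<close>, and \<open>b = 1\<close> is the
  tight case. In the lower bound on \<open>\<beta> \<sigma>\<close>, the discriminant is at most \<open>(N + 4)\<^sup>2\<close>.\<close>

lemma step_size_bounds:
  fixes \<rho> T T' \<sigma> L K :: real and b :: nat
  assumes "L > 0" "\<sigma> > 0" "0 < \<rho>" "2 * \<rho> < 1" "b \<ge> 1"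
    and T_lower: "1 / real b \<le> T + T'" and T_upper: "T + T' \<le> K * \<rho>"
    and discr: "(N_const \<rho> T T' (L / \<sigma>))\<^sup>2 + 12 * \<rho> * M_const \<rho> T T' (L / \<sigma>) \<ge> 0"
  defines "\<beta> \<equiv> beta_bar \<rho> T T' \<sigma> (L / \<sigma>) / 2"
  shows "\<beta> * \<sigma> \<le> 3 / 10" "\<beta> * L \<le> 1 / 4"
    "2126/1000 * (\<beta> * L) + 17644/1000 * (\<beta> * L / real b) \<le> 198/100"
    "1 / (2 * ((3 + 2 * K) * (L / \<sigma>) + 2 / \<rho>)) \<le> \<beta> * \<sigma>"
proof -
  define \<kappa> where "\<kappa> = L / \<sigma>"
  define \<Gamma> where "\<Gamma> = Gamma_const \<rho> T T'"
  define M where "M = M_const \<rho> T T' \<kappa>"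
  define N where "N = N_const \<rho> T T' \<kappa>"
  define s where "s = sqrt (N\<^sup>2 + 12 * \<rho> * M)"
  define E where "E = {3 / 5, 3 * \<rho> / (2 * (1 - 2 * \<rho>)), 1 / (2 * \<kappa>), 6 * \<rho> / (N + s)}"
  have \<beta>\<sigma>: "\<beta> * \<sigma> = Min E / 2"
    using assms(2) by (simp add: \<beta>_def beta_bar_def Let_def E_def s_def N_def M_def \<kappa>_def)
  have \<beta>L: "\<beta> * L = \<beta> * \<sigma> * \<kappa>" using assms(2) by (simp add: \<kappa>_def)
  have \<kappa>: "\<kappa> > 0" using assms by (simp add: \<kappa>_def)
  have fin: "finite E" "E \<noteq> {}" by (simp_all add: E_def)
  have \<Gamma>_lower: "\<Gamma> \<ge> \<rho> + 2 / real b" and \<Gamma>_upper: "\<Gamma> \<le> (1 + 2 * K) * \<rho>"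
    using T_lower T_upper by (simp_all add: \<Gamma>_def Gamma_const_def algebra_simps)
  have \<Gamma>_pos: "\<Gamma> > 0" using \<Gamma>_lower assms(3,5) by (smt (verit) divide_nonneg_nonneg of_nat_0_le_iff)
  have N: "N = 3 * (\<Gamma> * \<kappa>) + 2 * (1 - 2 * \<rho>)" and M: "M = 2 * (2 * \<Gamma> - 1) * \<kappa>"
    by (simp_all add: N_def M_def N_const_def M_const_def \<Gamma>_def)
  have \<Gamma>\<kappa>: "\<Gamma> * \<kappa> > 0" using \<Gamma>_pos \<kappa> by simp
  have N_pos: "N > 0" using \<Gamma>\<kappa> assms(4) by (simp add: N)
  have NM: "N\<^sup>2 + 12 * \<rho> * M \<le> (N + 4)\<^sup>2"
  proof -
    have "M \<le> 4 * (\<Gamma> * \<kappa>)" using \<kappa> by (simp add: M algebra_simps)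
    hence "12 * \<rho> * M \<le> 12 * \<rho> * (4 * (\<Gamma> * \<kappa>))" using assms(3) by (intro mult_left_mono) auto
    also have "\<dots> = 24 * (2 * \<rho> * (\<Gamma> * \<kappa>))" by simp
    also have "\<dots> \<le> 24 * (\<Gamma> * \<kappa>)" 
      using mult_right_mono[of "2 * \<rho>" 1 "\<Gamma> * \<kappa>"] assms(4) \<Gamma>\<kappa> by linarith
    also have "\<dots> \<le> 8 * N" using assms(4) by (simp add: N)
    finally show ?thesis by (simp add: power2_eq_square algebra_simps)
  qed
  have s_upper: "s \<le> N + 4"
    unfolding s_def using real_sqrt_le_mono[OF NM] N_pos by simp
  have "E \<subseteq> {x. \<beta> * \<sigma> \<le> x / 2}"
    using fin by (auto simp: \<beta>\<sigma>)
  hence upper: "\<beta> * \<sigma> \<le> 3 / 10" "\<beta> * \<sigma> \<le> 1 / (4 * \<kappa>)" "\<beta> * \<sigma> \<le> 3 * \<rho> / (N + s)"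
    by (auto simp: E_def)
  show "\<beta> * \<sigma> \<le> 3 / 10" by (rule upper(1))
  show bL: "\<beta> * L \<le> 1 / 4"
    unfolding \<beta>L using upper(2) \<kappa> by (simp add: field_simps)
  show "2126/1000 * (\<beta> * L) + 17644/1000 * (\<beta> * L / real b) \<le> 198/100"
  proof (cases "b \<ge> 4")
    case True
    have "\<beta> * L / real b \<le> (1 / 4) / real b" using bL by (intro divide_right_mono) auto
    also have "\<dots> \<le> (1 / 4) / 4" using True by (intro divide_left_mono) auto
    finally have "\<beta> * L / real b \<le> 1 / 16" by simp
    moreover have "2126/1000 * t + 17644/1000 * u \<le> 198/100" if "t \<le> 1/4" "u \<le> 1/16" for t u :: real
      using that by linarith
    ultimately show ?thesis using bL by blast
  next
    case False
    \<comment> \<open>The sign of \<open>M\<close> is that of \<open>2 \<Gamma> - 1\<close>, and only \<open>M \<ge> 0\<close> gives \<open>s \<ge> N\<close>.\<close>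
    have "1 / 2 \<le> 2 / real b" using False assms(5) by (simp add: field_simps)
    hence "M \<ge> 0" using \<Gamma>_lower assms(3) \<kappa> by (simp add: M)
    hence "s \<ge> N" unfolding s_def using assms(3) N_pos by (intro real_le_rsqrt) auto
    have "3 * \<rho> / (N + s) \<le> 3 * \<rho> / (2 * (3 * (\<Gamma> * \<kappa>)))"
      using \<open>s \<ge> N\<close> assms(3,4) \<Gamma>\<kappa> by (intro divide_left_mono) (auto simp: N)
    hence "\<beta> * \<sigma> * \<kappa> \<le> 3 * \<rho> / (2 * (3 * (\<Gamma> * \<kappa>))) * \<kappa>"
      using upper(3) \<kappa> by (intro mult_right_mono) auto
    also have "\<dots> = \<rho> / (2 * \<Gamma>)" using \<kappa> \<Gamma>_pos by (simp add: field_simps)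
    also have "\<dots> \<le> \<rho> / (2 * (\<rho> + 2 / real b))"
    proof -
      have "\<rho> + 2 / real b > 0" using assms(3) by (simp add: add_pos_nonneg)
      thus ?thesis using \<Gamma>_lower assms(3) \<Gamma>_pos by (intro divide_left_mono mult_pos_pos) auto
    qed
    also have "\<dots> \<le> real b / (2 * real b + 8)"
    proof -
      have "\<rho> * (2 * real b + 8) \<le> real b * (2 * (\<rho> + 2 / real b))"
        using assms(4,5) by (simp add: algebra_simps)
      thus ?thesis using assms(3,5) by (simp add: divide_simps add_pos_pos)
    qed
    finally have "\<beta> * L \<le> real b / (2 * real b + 8)" unfolding \<beta>L .
    moreover have "b = 1 \<or> b = 2 \<or> b = 3" using False assms(5) by auto
    moreover have "2126/1000 * t + 17644/1000 * (t / real b) \<le> 198/100"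
      if "t \<le> real b / (2 * real b + 8)" "b = 1 \<or> b = 2 \<or> b = 3" for t :: real
      using that by auto
    ultimately show ?thesis by blast
  qed
  show "1 / (2 * ((3 + 2 * K) * (L / \<sigma>) + 2 / \<rho>)) \<le> \<beta> * \<sigma>"
  proof -
    define W where "W = (3 + 2 * K) * \<kappa> + 2 / \<rho>"
    have K: "1 + 2 * K > 0"
      using \<Gamma>_upper \<Gamma>_pos assms(3) by (smt (verit) mult_nonpos_nonneg)
    have W: "2 * \<kappa> \<le> W" "2 / \<rho> \<le> W" "(1 + 2 * K) * \<kappa> + 2 / \<rho> \<le> W"
    proof -
      have "W = (1 + 2 * K) * \<kappa> + 2 * \<kappa> + 2 / \<rho>" by (simp add: W_def algebra_simps)
      moreover have "0 < (1 + 2 * K) * \<kappa>" using K \<kappa> by simp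
      moreover have "0 < 2 / \<rho>" using assms(3) by simp
      ultimately show "2 * \<kappa> \<le> W" "2 / \<rho> \<le> W" "(1 + 2 * K) * \<kappa> + 2 / \<rho> \<le> W"
        using \<kappa> by linarith+
    qed
    have W_pos: "W > 0" using W(1) \<kappa> by linarith
    have "1 / W \<le> 3 / 5"
    proof -
      have "4 \<le> 2 / \<rho>" using assms(3,4) by (simp add: field_simps)
      thus ?thesis using W W_pos by (simp add: field_simps)
    qed
    moreover have "1 / W \<le> 3 * \<rho> / (2 * (1 - 2 * \<rho>))"
    proof -
      have "1 / W \<le> \<rho> / 2" using W(2) W_pos assms(3) by (simp add: field_simps)
      also have "\<dots> \<le> 3 * \<rho> / (2 * (1 - 2 * \<rho>))"
        using assms(3,4) by (simp add: divide_simps)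
      finally show ?thesis .
    qed
    moreover have "1 / W \<le> 1 / (2 * \<kappa>)"
      using W(1) \<kappa> W_pos by (intro divide_left_mono) auto
    moreover have "1 / W \<le> 6 * \<rho> / (N + s)"
    proof -
      have "\<Gamma> * \<kappa> \<le> (1 + 2 * K) * \<rho> * \<kappa>" using \<Gamma>_upper \<kappa> by (intro mult_right_mono) auto
      hence "N + s \<le> 6 * ((1 + 2 * K) * \<rho> * \<kappa>) + 12"
        using s_upper assms(3) by (simp add: N)
      also have "\<dots> = 6 * \<rho> * ((1 + 2 * K) * \<kappa> + 2 / \<rho>)"
        using assms(3) by (simp add: algebra_simps)
      also have "\<dots> \<le> 6 * \<rho> * W" using W(3) assms(3) by (intro mult_left_mono) auto
      finally have "N + s \<le> 6 * \<rho> * W" .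
      moreover have "s \<ge> 0"
        using discr by (simp add: s_def N_def M_def \<kappa>_def)
      ultimately show ?thesis
        using N_pos W_pos by (simp add: divide_simps mult.commute)
    qed
    ultimately have "1 / W \<le> Min E" using fin by (auto simp: E_def)
    hence "1 / (2 * W) \<le> \<beta> * \<sigma>" by (simp add: \<beta>\<sigma>)
    thus ?thesis unfolding W_def \<kappa>_def .
  qed
qed


section \<open>Complexity of snapshot methods\<close>

text \<open>The contraction factor is \<open>1 - \<omega>\<close> with \<open>1 / \<omega>\<close> of order \<open>\<kappa> + 1 / \<rho>\<close>, hence at most of order
  \<open>max \<kappa> (n powr (1/3))\<close>; multiplied by a cost of order \<open>n powr (2/3)\<close> per iteration, this is
  \<open>max n (n powr (2/3) * \<kappa>)\<close>.\<close>

lemma (in snapshot_method) complexity: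
  fixes T T' K1 K2 K3 D :: real
  assumes x0: "x0 \<in> Rspace p" and s0: "s0 \<in> I" "Q s0 = P x0" and D: "vnorm p (x0 - xs) = D"
    and T_lower: "1 / real b \<le> T + T'" and T_upper: "T + T' \<le> K1 * \<rho>"
    and rho_lower: "1 / \<rho> \<le> K2 * real n powr (1/3)"
    and cost: "c \<le> K3 * real n powr (2/3)" "K3 \<ge> 0"
    and discr: "(N_const \<rho> T T' (L / \<sigma>))\<^sup>2 + 12 * \<rho> * M_const \<rho> T T' (L / \<sigma>) \<ge> 0"
    and eps: "0 < \<epsilon>" "\<epsilon> < 1 / (3 * (3 + K1) * D\<^sup>2 + 1)"
  defines "\<beta> \<equiv> beta_bar \<rho> T T' \<sigma> (L / \<sigma>) / 2"
  shows "\<exists>k. expected_sq_error p xs (vfkm (\<lambda>_. 1/3) (\<lambda>_. 4 * \<beta> / 3) est x0 s0 k) \<le> \<epsilon>\<^sup>2 \<and>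
             expected_evals (vfkm (\<lambda>_. 1/3) (\<lambda>_. 4 * \<beta> / 3) est x0 s0 k)
               \<le> (1 + K3 + 1200 * K3 * (3 + 2 * K1 + 2 * K2)) *
                  (real n + max (real n) (real n powr (2/3) * (L / \<sigma>)) * ln (1 / \<epsilon>))"
proof -
  define \<kappa> where "\<kappa> = L / \<sigma>"
  define m where "m = max \<kappa> (real n powr (1/3))"
  define W where "W = (3 + 2 * K1) * \<kappa> + 2 / \<rho>"
  define \<omega> where "\<omega> = 1 / (400 * W)"
  define A where "A = 3 * (3 + K1) * D\<^sup>2 + 1"
  note bounds = step_size_bounds[OF L_pos \<sigma>_pos rho_pos rho_less b_ge_1 T_lower T_upper discr,
      folded \<beta>_def]
  have \<kappa>: "\<kappa> > 0" using L_pos \<sigma>_pos by (simp add: \<kappa>_def)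
  have brho: "1 / (real b * \<rho>) \<le> K1"
    using order_trans[OF T_lower T_upper] rho_pos b_ge_1 by (simp add: field_simps)
  have K1: "K1 > 0"
    using brho rho_pos b_ge_1 by (smt (verit) divide_pos_pos mult_pos_pos of_nat_0_less_iff zero_less_one order_less_le_trans)
  have W: "W > 0" "1 / \<rho> \<le> W"
    using \<kappa> K1 rho_pos by (auto simp: W_def add_pos_pos divide_right_mono intro: add_increasing)
  have lower: "1 / (2 * W) \<le> \<beta> * \<sigma>" using bounds(4) by (simp add: W_def \<kappa>_def)
  have "0 < 1 / (2 * W)" using W by simp
  hence "\<beta> * \<sigma> > 0" using lower by linarith
  hence \<beta>: "\<beta> > 0" using \<sigma>_pos by (simp add: zero_less_mult_iff)
  have \<omega>: "\<omega> > 0" "\<omega> \<le> \<beta> * \<sigma> / 200" "\<omega> \<le> \<rho> / 200"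
  proof -
    show "\<omega> > 0" using W by (simp add: \<omega>_def)
    show "\<omega> \<le> \<beta> * \<sigma> / 200" using lower by (simp add: \<omega>_def)
    have "1 / W \<le> \<rho>" using W rho_pos by (simp add: field_simps)
    thus "\<omega> \<le> \<rho> / 200" using rho_pos by (simp add: \<omega>_def)
  qed
  interpret stable_snapshot_method p n G L \<sigma> xs b \<rho> c refresh tab I est \<beta> \<omega>
    by unfold_locales (use \<beta> \<omega> bounds in auto)

  have A: "A \<ge> 1" using K1 by (simp add: A_def)
  have eps': "\<epsilon> < 1 / A" using eps(2) by (simp add: A_def)
  hence "\<epsilon> * A < 1" using A by (simp add: field_simps)
  moreover have "\<epsilon> \<le> \<epsilon> * A" using A eps(1) by simp
  ultimately have eps1: "\<epsilon> < 1" by simp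
  define l where "l = ln (1 / \<epsilon>)"
  have l: "l > 0" using eps(1) eps1 by (simp add: l_def)
  \<comment> \<open>Below the threshold, one factor \<open>\<epsilon>\<close> absorbs the initial Lyapunov value \<open>A\<close>; the contraction
    therefore has to supply \<open>\<epsilon> ^ 3\<close>.\<close>
  define k where "k = nat \<lceil>3 * l / \<omega>\<rceil>"
  have k_lower: "3 * l \<le> \<omega> * real k"
  proof -
    have "3 * l / \<omega> \<le> real k" unfolding k_def by linarith
    thus ?thesis using \<omega>(1) by (simp add: field_simps)
  qed
  have k_upper: "real k \<le> 1200 * l * W + 1"
  proof -
    have "3 * l / \<omega> \<ge> 0" using l \<omega>(1) by simp
    hence "real k \<le> 3 * l / \<omega> + 1" unfolding k_def by linarith
    thus ?thesis by (simp add: \<omega>_def mult_ac)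
  qed

  have "expected_sq_error p xs (law x0 s0 (Suc k)) \<le>
      3 * (3 + 1 / (real b * \<rho>)) * D\<^sup>2 * (1 - \<omega>) ^ k"
    using error_linear_convergence[OF x0 s0, of k] D by (simp only:)
  also have "\<dots> \<le> A * (1 - \<omega>) ^ k"
  proof (rule mult_right_mono)
    have "3 * (3 + 1 / (real b * \<rho>)) * D\<^sup>2 \<le> 3 * (3 + K1) * D\<^sup>2"
      using brho by (intro mult_right_mono) auto
    thus "3 * (3 + 1 / (real b * \<rho>)) * D\<^sup>2 \<le> A" by (simp add: A_def)
    show "0 \<le> (1 - \<omega>) ^ k" using omega_small by simp
  qed
  also have "(1 - \<omega>) ^ k \<le> exp (- \<omega>) ^ k"
    using exp_ge_add_one_self[of "- \<omega>"] omega_small by (intro power_mono) auto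
  also have "exp (- \<omega>) ^ k = exp (- (\<omega> * real k))"
    by (simp add: exp_of_nat_mult[symmetric] mult.commute)
  also have "\<dots> \<le> exp (- (3 * l))" using k_lower by simp
  also have "\<dots> = \<epsilon> ^ 3"
  proof -
    have "- (3 * l) = of_nat 3 * ln \<epsilon>" using eps(1) by (simp add: l_def ln_div)
    thus ?thesis using eps(1) by (simp only: exp_of_nat_mult exp_ln)
  qed
  also have "A * \<epsilon> ^ 3 = (\<epsilon> * A) * \<epsilon>\<^sup>2" by (simp add: power2_eq_square power3_eq_cube)
  also have "\<dots> \<le> \<epsilon>\<^sup>2" 
    using mult_right_mono[of "\<epsilon> * A" 1 "\<epsilon>\<^sup>2"] \<open>\<epsilon> * A < 1\<close> by simp
  finally have error: "expected_sq_error p xs (law x0 s0 (Suc k)) \<le> \<epsilon>\<^sup>2"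
    using A by simp

  define N23 where "N23 = real n powr (2/3)"
  have n: "real n \<ge> 1" using n_ge_1 by simp
  have N23: "N23 \<ge> 0" "N23 \<le> real n" "N23 * real n powr (1/3) = real n"
  proof -
    show "N23 \<ge> 0" by (simp add: N23_def)
    show "N23 \<le> real n" using powr_mono[of "2/3" 1 "real n"] n by (simp add: N23_def)
    show "N23 * real n powr (1/3) = real n" using n by (simp add: N23_def flip: powr_add)
  qed
  have Nm: "N23 * m = max (real n) (N23 * \<kappa>)"
    using N23 by (simp add: m_def max_mult_distrib_left max.commute)
  have K2: "K2 \<ge> 0"
  proof -
    have "0 < K2 * real n powr (1/3)"
      using rho_lower rho_pos by (smt (verit) divide_pos_pos)
    thus ?thesis by (simp add: zero_less_mult_iff)
  qed
  have Wm: "W \<le> (3 + 2 * K1 + 2 * K2) * m"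
  proof -
    have "(3 + 2 * K1) * \<kappa> \<le> (3 + 2 * K1) * m" using K1 by (intro mult_left_mono) (auto simp: m_def)
    moreover have "K2 * real n powr (1/3) \<le> K2 * m" using K2 by (intro mult_left_mono) (auto simp: m_def)
    ultimately show ?thesis using rho_lower by (simp add: W_def algebra_simps)
  qed
  have "real k * c \<le> real k * (K3 * N23)"
    using cost(1) by (intro mult_left_mono) (auto simp: N23_def)
  also have "\<dots> \<le> (1200 * l * W + 1) * (K3 * N23)"
    using k_upper cost(2) N23(1) by (intro mult_right_mono) auto
  also have "\<dots> = 1200 * K3 * l * (N23 * W) + K3 * N23" by (simp add: algebra_simps)
  also have "\<dots> \<le> 1200 * K3 * l * (N23 * ((3 + 2 * K1 + 2 * K2) * m)) + K3 * real n"
    using Wm l cost(2) N23 by (intro add_mono mult_left_mono) auto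
  also have "\<dots> = 1200 * K3 * (3 + 2 * K1 + 2 * K2) * (N23 * m * l) + K3 * real n"
    by (simp add: mult_ac)
  finally have "expected_evals (law x0 s0 (Suc k)) \<le>
      real n + (1200 * K3 * (3 + 2 * K1 + 2 * K2) * (N23 * m * l) + K3 * real n)"
    using expected_evals_le[of x0 s0 k] by linarith
  also have "\<dots> \<le> (1 + K3 + 1200 * K3 * (3 + 2 * K1 + 2 * K2)) * (real n + N23 * m * l)"
  proof -
    have "0 \<le> (1 + K3) * (N23 * m * l) + 1200 * K3 * (3 + 2 * K1 + 2 * K2) * real n"
      using cost(2) N23(1) l K1 K2 \<kappa> by (auto simp: m_def le_max_iff_disj)
    thus ?thesis by (simp add: algebra_simps)
  qed
  finally have "expected_evals (law x0 s0 (Suc k)) \<le>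
      (1 + K3 + 1200 * K3 * (3 + 2 * K1 + 2 * K2)) *
        (real n + max (real n) (real n powr (2/3) * (L / \<sigma>)) * ln (1 / \<epsilon>))"
    unfolding Nm unfolding l_def N23_def \<kappa>_def .
  with error show ?thesis by blast
qed


section \<open>Loopless SVRG and SAGA as snapshot methods\<close>

lemma svrg_snapshot_method:
  assumes "vfkm_problem p n G L \<sigma> xs" "b \<ge> 1" "0 < q" "q < 1"
  shows "snapshot_method p n G L \<sigma> xs b (svrg_rho q) (3 * real b + real n * q)
      (\<lambda>x' w. map_pmf (\<lambda>u. (if u then x' else w, 3 * b + (if u then n else 0))) (bernoulli_pmf q))
      (\<lambda>w i. G i w) (Rspace p) (svrg_estimator n G (\<lambda>_. 1/2) b q)"
proof
  fix k x' x w
  show "svrg_estimator n G (\<lambda>_. 1/2) b q 0 x' x w = return_pmf (exact_S n G (1/2) x' x, w, n)"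
    by (simp add: svrg_estimator_def)
  have snapshot: "(\<lambda>j. (1 - 1/2) * (mean_op n G w' j - batch_avg B (\<lambda>i. G i w') j)
        + batch_avg B (\<lambda>i. G i x) j - 1/2 * batch_avg B (\<lambda>i. G i x') j) =
      snapshot_S n G x' x (\<lambda>i. G i w') B" for w' B
    by (simp add: snapshot_S_batch_avg mean_op_def fun_eq_iff field_simps)
  show "svrg_estimator n G (\<lambda>_. 1/2) b q k x' x w =
      map_pmf (\<lambda>((w', m), B). (snapshot_S n G x' x (\<lambda>i. G i w') B, w', m))
        (pair_pmf (map_pmf (\<lambda>u. (if u then x' else w, 3 * b + (if u then n else 0)))
           (bernoulli_pmf q)) (minibatch n b))" if "k \<ge> 1"
    using that unfolding svrg_estimator_def snapshot Let_def
    by (simp add: pair_map_pmf1 pmf.map_comp o_def case_prod_unfold apfst_def map_prod_def)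
next
  fix x' w :: rvec
  show "measure_pmf.expectation (map_pmf (\<lambda>u. (if u then x' else w, 3 * b + (if u then n else 0)))
          (bernoulli_pmf q)) (\<lambda>(w', m). deviation p n G xs (\<lambda>i. G i w')) =
      (1 - 2 * svrg_rho q) * deviation p n G xs (\<lambda>i. G i w)
        + 2 * svrg_rho q * deviation p n G xs (\<lambda>i. G i x')"
    using assms by (simp add: svrg_rho_def algebra_simps)
  show "measure_pmf.expectation (map_pmf (\<lambda>u. (if u then x' else w, 3 * b + (if u then n else 0)))
          (bernoulli_pmf q)) (\<lambda>(s', m). real m) \<le> 3 * real b + real n * q"
    using assms by (simp add: algebra_simps)
qed (use assms in \<open>auto simp: svrg_rho_def vfkm_problem_def split: if_splits\<close>)

text \<open>Double counting, in the form needed for the probability \<open>b / n\<close> that a uniformly random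
  \<open>b\<close>-subset contains \<open>i\<close>.\<close>

lemma card_subsets_containing:
  assumes "i \<in> {1..n}" "b \<ge> 1"
  shows "n * card {A. A \<subseteq> {1..n} \<and> card A = b \<and> i \<in> A} = b * (n choose b)"
proof -
  have "bij_betw (insert i) {A. A \<subseteq> {1..n} - {i} \<and> card A = b - 1}
      {A. A \<subseteq> {1..n} \<and> card A = b \<and> i \<in> A}"
  proof (rule bij_betwI[where g="\<lambda>A. A - {i}"])
    show "insert i \<in> {A. A \<subseteq> {1..n} - {i} \<and> card A = b - 1} \<rightarrow>
        {A. A \<subseteq> {1..n} \<and> card A = b \<and> i \<in> A}"
    proof
      fix A assume "A \<in> {A. A \<subseteq> {1..n} - {i} \<and> card A = b - 1}"
      moreover from this have "finite A" "i \<notin> A" by (auto intro: finite_subset)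
      ultimately show "insert i A \<in> {A. A \<subseteq> {1..n} \<and> card A = b \<and> i \<in> A}"
        using assms by auto
    qed
  qed (use assms in \<open>auto simp: insert_absorb\<close>)
  hence "card {A. A \<subseteq> {1..n} \<and> card A = b \<and> i \<in> A} = (n - 1) choose (b - 1)"
    using assms(1) by (simp add: bij_betw_same_card[symmetric] n_subsets)
  moreover have "b * (n choose b) = n * ((n - 1) choose (b - 1))"
    using assms times_binomial_minus1_eq[of b n] by simp
  ultimately show ?thesis by simp
qed

lemma expectation_random_subset:
  fixes u v :: real
  assumes "i \<in> {1..n}" "1 \<le> b" "b \<le> n"
  shows "measure_pmf.expectation (pmf_of_set {A. A \<subseteq> {1..n} \<and> card A = b}) (\<lambda>A. if i \<in> A then u else v) =
         real b / real n * u + (1 - real b / real n) * v"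
proof -
  let ?F = "{A. A \<subseteq> {1..n} \<and> card A = b}"
  have fin: "finite ?F" by simp
  have card: "card ?F = n choose b" by (simp add: n_subsets)
  hence pos: "card ?F > 0" using assms by simp
  hence ne: "?F \<noteq> {}" by (metis card.empty less_numeral_extra(3))
  have "?F \<inter> {A. i \<in> A} = {A. A \<subseteq> {1..n} \<and> card A = b \<and> i \<in> A}" by auto
  hence "n * card (?F \<inter> {A. i \<in> A}) = b * card ?F"
    using card_subsets_containing[OF assms(1,2)] card by simp
  hence in_card: "real n * real (card (?F \<inter> {A. i \<in> A})) = real b * real (card ?F)"
    by (simp only: of_nat_mult[symmetric])
  have split: "(if i \<in> A then u else v) = v + (if i \<in> A then u - v else 0)" for A by simp
  have "(\<Sum>A\<in>?F. if i \<in> A then u else v) =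
      real (card ?F) * v + real (card (?F \<inter> {A. i \<in> A})) * (u - v)"
    unfolding split using fin by (simp add: sum.distrib sum.If_cases)
  also have "real (card (?F \<inter> {A. i \<in> A})) = real b / real n * real (card ?F)"
    using in_card assms(1) by (simp add: nonzero_eq_divide_eq mult.commute)
  finally have "(\<Sum>A\<in>?F. if i \<in> A then u else v) / real (card ?F) =
      (v + real b / real n * (u - v)) * real (card ?F) / real (card ?F)"
    by (simp add: algebra_simps)
  also have "\<dots> = v + real b / real n * (u - v)"
    by (rule nonzero_mult_div_cancel_right) (use pos in linarith)
  also have "\<dots> = real b / real n * u + (1 - real b / real n) * v"
    by (simp add: algebra_simps diff_divide_distrib)
  finally show ?thesis using ne fin by (simp add: integral_pmf_of_set)
qed

lemma saga_snapshot_method: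
  assumes "vfkm_problem p n G L \<sigma> xs" "b \<ge> 1" "b < n"
  shows "snapshot_method p n G L \<sigma> xs b (saga_rho n b) (3 * real b)
      (\<lambda>x' H. map_pmf (\<lambda>A. (\<lambda>i. if i \<in> A then G i x' else H i, 3 * b))
         (pmf_of_set {A. A \<subseteq> {1..n} \<and> card A = b}))
      (\<lambda>H. H) {H. \<forall>i\<in>{1..n}. H i \<in> Rspace p} (saga_estimator n G (\<lambda>_. 1/2) b)"
proof
  let ?F = "{A. A \<subseteq> {1..n} \<and> card A = b}"
  have "card ?F = n choose b" by (simp add: n_subsets)
  hence "card ?F > 0" using assms by simp
  hence F: "finite ?F" "?F \<noteq> {}" by (simp, metis card.empty less_numeral_extra(3))
  {
    fix k x' x H
    show "saga_estimator n G (\<lambda>_. 1/2) b 0 x' x H = return_pmf (exact_S n G (1/2) x' x, H, n)"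
      by (simp add: saga_estimator_def)
    have snapshot: "(\<lambda>j. (1 - 1/2) * avg n H' j
          + (batch_avg B (\<lambda>i. G i x) j - 1/2 * batch_avg B (\<lambda>i. G i x') j
             - (1 - 1/2) * batch_avg B H' j)) = snapshot_S n G x' x H' B" for H' B
      by (simp add: snapshot_S_batch_avg fun_eq_iff field_simps)
    show "saga_estimator n G (\<lambda>_. 1/2) b k x' x H =
        map_pmf (\<lambda>((H', m), B). (snapshot_S n G x' x H' B, H', m))
          (pair_pmf (map_pmf (\<lambda>A. (\<lambda>i. if i \<in> A then G i x' else H i, 3 * b)) (pmf_of_set ?F))
             (minibatch n b))" if "k \<ge> 1"
      using that unfolding saga_estimator_def snapshot Let_def
      by (subst pair_commute_pmf) (simp add: pair_map_pmf1 pmf.map_comp o_def case_prod_unfold apfst_def map_prod_def)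
  next
    fix x' :: rvec and H
    show "finite (set_pmf (map_pmf (\<lambda>A. (\<lambda>i. if i \<in> A then G i x' else H i, 3 * b)) (pmf_of_set ?F)))"
      using F by simp
    have "(vnorm p ((if i \<in> A then G i x' else H i) - G i xs))\<^sup>2 =
        (if i \<in> A then (vnorm p (G i x' - G i xs))\<^sup>2 else (vnorm p (H i - G i xs))\<^sup>2)" for i A
      by simp
    hence component: "measure_pmf.expectation (pmf_of_set ?F)
          (\<lambda>A. (vnorm p ((if i \<in> A then G i x' else H i) - G i xs))\<^sup>2) =
        real b / real n * (vnorm p (G i x' - G i xs))\<^sup>2
            + (1 - real b / real n) * (vnorm p (H i - G i xs))\<^sup>2" if "i \<in> {1..n}" for i
      using expectation_random_subset[OF that] assms by (simp only:)
    have int: "integrable (measure_pmf (pmf_of_set ?F)) f" for f :: "nat set \<Rightarrow> real"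
      using F by (intro integrable_finite_pmf) simp
    have "measure_pmf.expectation (map_pmf (\<lambda>A. (\<lambda>i. if i \<in> A then G i x' else H i, 3 * b))
          (pmf_of_set ?F)) (\<lambda>(H', m). deviation p n G xs H') =
        (\<Sum>i=1..n. real b / real n * (vnorm p (G i x' - G i xs))\<^sup>2
            + (1 - real b / real n) * (vnorm p (H i - G i xs))\<^sup>2) / real n"
      unfolding deviation_def
      by (simp only: integral_map_pmf prod.case Bochner_Integration.integral_divide_zero
          Bochner_Integration.integral_sum int component cong: sum.cong)
    also have "\<dots> = (1 - 2 * saga_rho n b) * deviation p n G xs H
          + 2 * saga_rho n b * deviation p n G xs (\<lambda>i. G i x')"
      by (simp add: saga_rho_def deviation_def sum.distrib sum_distrib_left sum_divide_distrib
          add_divide_distrib)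
    finally show "measure_pmf.expectation (map_pmf (\<lambda>A. (\<lambda>i. if i \<in> A then G i x' else H i, 3 * b))
          (pmf_of_set ?F)) (\<lambda>(H', m). deviation p n G xs H') =
        (1 - 2 * saga_rho n b) * deviation p n G xs H
          + 2 * saga_rho n b * deviation p n G xs (\<lambda>i. G i x')" .
    show "measure_pmf.expectation (map_pmf (\<lambda>A. (\<lambda>i. if i \<in> A then G i x' else H i, 3 * b))
          (pmf_of_set ?F)) (\<lambda>(s', m). real m) \<le> 3 * real b"
      by simp
  }
qed (use assms in \<open>auto simp: saga_rho_def vfkm_problem_def Pi_iff split: if_splits\<close>)


section \<open>Parameters of exact order and the complexity bounds\<close>

text \<open>The complexity bounds concern every \<open>n \<ge> 1\<close>, so the finitely many indices at which an
  asymptotic bound may fail are absorbed into its constant, using positivity.\<close>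

lemma bigo_bound_everywhere:
  fixes f g :: "nat \<Rightarrow> real"
  assumes "f \<in> O(g)" "\<And>n. n \<ge> 1 \<Longrightarrow> 0 < f n" "\<And>n. n \<ge> 1 \<Longrightarrow> 0 < g n"
  obtains c where "c > 0" "\<And>n. n \<ge> 1 \<Longrightarrow> f n \<le> c * g n"
proof -
  obtain c0 where c0: "c0 > 0" "eventually (\<lambda>n. norm (f n) \<le> c0 * norm (g n)) sequentially"
    using assms(1) by (elim landau_o.bigE)
  then obtain m where m: "\<And>n. n \<ge> m \<Longrightarrow> norm (f n) \<le> c0 * norm (g n)"
    by (auto simp: eventually_sequentially)
  define c where "c = c0 + (\<Sum>n=1..m. f n / g n)"
  have nonneg: "(\<Sum>n=1..m. f n / g n) \<ge> 0"
    using assms(2,3) by (intro sum_nonneg) (simp add: less_imp_le)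
  show ?thesis
  proof
    show "c > 0" using c0 nonneg by (simp add: c_def)
    fix n :: nat assume n: "n \<ge> 1"
    have fg: "f n > 0" "g n > 0" using assms(2,3) n by auto
    show "f n \<le> c * g n"
    proof (cases "n \<ge> m")
      case True
      have "f n \<le> c0 * g n" using m[OF True] fg by simp
      also have "\<dots> \<le> c * g n" using nonneg fg by (intro mult_right_mono) (auto simp: c_def)
      finally show ?thesis .
    next
      case False
      have "f n / g n \<le> (\<Sum>n=1..m. f n / g n)"
        using False n assms(2,3) by (intro member_le_sum) (auto simp: less_imp_le)
      also have "\<dots> \<le> c" using c0 by (simp add: c_def)
      finally show ?thesis using fg by (simp add: field_simps)
    qed
  qed
qed

lemma bigtheta_bounds_everywhere:
  fixes f :: "nat \<Rightarrow> real"
  assumes "f \<in> \<Theta>(\<lambda>n. real n powr e)" "\<And>n. n \<ge> 1 \<Longrightarrow> 0 < f n"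
  obtains c d where "c > 0" "d > 0"
    "\<And>n. n \<ge> 1 \<Longrightarrow> c * real n powr e \<le> f n" "\<And>n. n \<ge> 1 \<Longrightarrow> f n \<le> d * real n powr e"
proof -
  have upper: "f \<in> O(\<lambda>n. real n powr e)" and lower: "(\<lambda>n. real n powr e) \<in> O(f)"
    using assms(1) by (auto simp: bigtheta_def bigomega_iff_bigo)
  have pos: "0 < real n powr e" if "n \<ge> 1" for n :: nat
    using that by simp
  obtain d where d: "d > 0" "\<And>n. n \<ge> 1 \<Longrightarrow> f n \<le> d * real n powr e"
    using bigo_bound_everywhere[OF upper assms(2) pos] by blast
  obtain c where c: "c > 0" "\<And>n. n \<ge> 1 \<Longrightarrow> real n powr e \<le> c * f n"
    using bigo_bound_everywhere[OF lower pos assms(2)] by blast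
  show ?thesis
  proof
    show "1 / c > 0" "d > 0" using c d by auto
    show "1 / c * real n powr e \<le> f n" "f n \<le> d * real n powr e" if "n \<ge> 1" for n
      using c(1) c(2)[OF that] d(2)[OF that] by (auto simp: field_simps)
  qed
qed

text \<open>The orders of \<open>b\<close> and \<open>q\<close> enter through \<open>b q\<^sup>2\<close>, which is bounded below: the two variance
  constants sum to at most \<open>8 / (b q)\<close>, hence to a multiple of \<open>q\<close>.\<close>

lemma svrg_constants:
  fixes c d :: real
  assumes "n \<ge> 1" "b \<ge> 1" "0 < q" "q < 1" "c > 0" "d > 0"
    and b: "c * real n powr (2/3) \<le> real b" and q: "d * real n powr (-1/3) \<le> q"
  shows "1 / real b \<le> svrg_T b q + svrg_T' b q"
    "svrg_T b q + svrg_T' b q \<le> 16 / (c * d\<^sup>2) * svrg_rho q"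
    "1 / svrg_rho q \<le> 2 / d * real n powr (1/3)"
proof -
  have sum: "svrg_T b q + svrg_T' b q = (8 - 12 * q + 5 * q\<^sup>2) / (real b * q)"
    by (simp add: svrg_T_def svrg_T'_def add_divide_distrib[symmetric])
  have "0 \<le> (1 - q) * (8 - 5 * q)" using assms(4) by simp
  hence "q \<le> 8 - 12 * q + 5 * q\<^sup>2" by (simp add: power2_eq_square algebra_simps)
  hence "q / (real b * q) \<le> svrg_T b q + svrg_T' b q"
    unfolding sum using assms(3) by (intro divide_right_mono) auto
  thus "1 / real b \<le> svrg_T b q + svrg_T' b q" using assms(3) by simp
  have powr: "real n powr (2/3) * (real n powr (-1/3))\<^sup>2 = 1"
    using assms(1) by (simp add: power2_eq_square flip: powr_add)
  have "c * d\<^sup>2 = (c * real n powr (2/3)) * (d * real n powr (-1/3))\<^sup>2"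
    using powr by (simp add: power_mult_distrib mult_ac)
  also have "\<dots> \<le> real b * q\<^sup>2"
    using b q assms(3,5,6) by (intro mult_mono power_mono) auto
  finally have bq: "c * d\<^sup>2 \<le> real b * q\<^sup>2" .
  have "svrg_T b q + svrg_T' b q \<le> 8 / (real b * q)"
    unfolding sum using assms(3,4) mult_left_mono[of q 1 q]
    by (intro divide_right_mono) (auto simp: power2_eq_square)
  also have "\<dots> = 8 / (real b * q\<^sup>2) * q" using assms(3) by (simp add: power2_eq_square)
  also have "\<dots> \<le> 8 / (c * d\<^sup>2) * q"
    using bq assms by (intro mult_right_mono divide_left_mono) auto
  finally show "svrg_T b q + svrg_T' b q \<le> 16 / (c * d\<^sup>2) * svrg_rho q"
    by (simp add: svrg_rho_def)
  have "2 / q \<le> 2 / (d * real n powr (-1/3))"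
    using q assms by (intro divide_left_mono) auto
  also have "\<dots> = 2 / d * real n powr (1/3)"
    using assms(1) by (simp add: powr_minus field_simps)
  finally show "1 / svrg_rho q \<le> 2 / d * real n powr (1/3)" by (simp add: svrg_rho_def)
qed

text \<open>Here the two variance constants sum to at most \<open>13 n / b\<^sup>2\<close>, which is a multiple of
  \<open>\<rho> = b / (2 n)\<close> as soon as \<open>n\<^sup>2 / b ^ 3\<close> is bounded.\<close>

lemma saga_constants:
  fixes c :: real
  assumes "1 \<le> b" "b \<le> n" "c > 0" and b: "c * real n powr (2/3) \<le> real b"
  shows "1 / real b \<le> saga_T n b + saga_T' n b"
    "saga_T n b + saga_T' n b \<le> 26 / c ^ 3 * saga_rho n b"
    "1 / saga_rho n b \<le> 2 / c * real n powr (1/3)"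
proof -
  define x y where "x = real n" and "y = real b"
  have xy: "1 \<le> y" "y \<le> x" using assms by (simp_all add: x_def y_def)
  have sum: "saga_T n b + saga_T' n b = (4 * (x - y) * (2 * x + y) + y\<^sup>2) / (x * y\<^sup>2)"
    by (simp add: saga_T_def saga_T'_def x_def y_def add_divide_distrib[symmetric])
  have "0 \<le> (x - y) * (8 * x + 3 * y)" using xy by simp
  hence "x * y \<le> 4 * (x - y) * (2 * x + y) + y\<^sup>2"
    by (simp add: power2_eq_square algebra_simps)
  hence "x * y / (x * y\<^sup>2) \<le> saga_T n b + saga_T' n b"
    unfolding sum using xy by (intro divide_right_mono) auto
  moreover have "x * y / (x * y\<^sup>2) = 1 / y" using xy by (simp add: power2_eq_square)
  ultimately show "1 / real b \<le> saga_T n b + saga_T' n b" by (simp add: y_def)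
  have "c ^ 3 * x\<^sup>2 = (c * real n powr (2/3)) ^ 3"
  proof -
    have "(real n powr (2/3)) ^ 3 = real n powr (2/3 * real 3)"
      using assms by (simp add: powr_power)
    hence "(real n powr (2/3)) ^ 3 = x\<^sup>2" using assms by (simp add: x_def)
    thus ?thesis by (simp only: power_mult_distrib)
  qed
  also have "\<dots> \<le> y ^ 3" using b assms(3) by (auto intro!: power_mono simp: y_def)
  finally have cube: "c ^ 3 * x\<^sup>2 \<le> y ^ 3" .
  have "4 * (x - y) * (2 * x + y) + y\<^sup>2 \<le> 4 * x * (3 * x) + x\<^sup>2"
    using xy by (intro add_mono mult_mono power_mono) auto
  hence "saga_T n b + saga_T' n b \<le> (13 * x\<^sup>2) / (x * y\<^sup>2)"
    unfolding sum using xy by (intro divide_right_mono) (auto simp: power2_eq_square)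
  also have "\<dots> = 26 * (x\<^sup>2 / y ^ 3) * (y / (2 * x))"
    using xy by (simp add: power2_eq_square power3_eq_cube)
  also have "\<dots> \<le> 26 * (1 / c ^ 3) * (y / (2 * x))"
    using cube xy assms(3)
    by (intro mult_right_mono mult_left_mono) (auto simp: divide_simps mult.commute)
  finally show "saga_T n b + saga_T' n b \<le> 26 / c ^ 3 * saga_rho n b"
    by (simp add: saga_rho_def x_def y_def)
  have "2 * x / y \<le> 2 * x / (c * real n powr (2/3))"
    using b xy assms by (intro divide_left_mono) (auto simp: x_def y_def)
  also have "\<dots> = 2 / c * real n powr (1/3)"
  proof -
    have "x = real n powr (2/3) * real n powr (1/3)"
      using assms by (simp add: x_def flip: powr_add)
    thus ?thesis using assms by simp
  qed
  finally show "1 / saga_rho n b \<le> 2 / c * real n powr (1/3)"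
    by (simp add: saga_rho_def x_def y_def)
qed

lemma svrg_complexity:
  fixes b :: "nat \<Rightarrow> nat" and q :: "nat \<Rightarrow> real" and D :: real
  assumes range: "\<forall>n\<ge>1. b n \<ge> 1 \<and> 0 < q n \<and> q n < 1"
    and b_order: "(\<lambda>n. real (b n)) \<in> \<Theta>(\<lambda>n. real n powr (2/3))"
    and q_order: "q \<in> \<Theta>(\<lambda>n. real n powr (-1/3))"
  shows "\<exists>C>0. \<exists>\<epsilon>0>0. \<forall>p n G L \<sigma> xs x0.
           vfkm_problem p n G L \<sigma> xs \<longrightarrow> x0 \<in> Rspace p \<longrightarrow> vnorm p (x0 - xs) = D \<longrightarrow>
           (let \<kappa> = L / \<sigma>; \<rho> = svrg_rho (q n); T = svrg_T (b n) (q n); T' = svrg_T' (b n) (q n);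
                \<beta> = beta_bar \<rho> T T' \<sigma> \<kappa> / 2;
                X = vfkm (\<lambda>_. 1/3) (\<lambda>_. 4 * \<beta> / 3)
                      (svrg_estimator n G (\<lambda>_. 1/2) (b n) (q n)) x0 x0
            in (N_const \<rho> T T' \<kappa>)\<^sup>2 + 12 * \<rho> * M_const \<rho> T T' \<kappa> \<ge> 0 \<longrightarrow> 2 * \<rho> < 1 \<longrightarrow>
               (\<forall>\<epsilon>. 0 < \<epsilon> \<and> \<epsilon> < \<epsilon>0 \<longrightarrow>
                  (\<exists>k. expected_sq_error p xs (X k) \<le> \<epsilon>\<^sup>2 \<and>
                       expected_evals (X k)
                         \<le> C * (real n + max (real n) (real n powr (2/3) * \<kappa>) * ln (1 / \<epsilon>)))))"
proof -
  have b_pos: "0 < real (b n)" if "n \<ge> 1" for n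
    using range that by fastforce
  obtain c c' where c: "c > 0" "c' > 0" "\<And>n. n \<ge> 1 \<Longrightarrow> c * real n powr (2/3) \<le> real (b n)"
      "\<And>n. n \<ge> 1 \<Longrightarrow> real (b n) \<le> c' * real n powr (2/3)"
    using bigtheta_bounds_everywhere[OF b_order] b_pos by blast
  obtain d d' where d: "d > 0" "d' > 0" "\<And>n. n \<ge> 1 \<Longrightarrow> d * real n powr (-1/3) \<le> q n"
      "\<And>n. n \<ge> 1 \<Longrightarrow> q n \<le> d' * real n powr (-1/3)"
    using bigtheta_bounds_everywhere[OF q_order] range by blast
  define K1 K2 K3 where "K1 = 16 / (c * d\<^sup>2)" and "K2 = 2 / d" and "K3 = 3 * c' + d'"
  have K: "K1 > 0" "K2 > 0" "K3 > 0" using c d by (auto simp: K1_def K2_def K3_def)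
  have cost: "3 * real (b n) + real n * q n \<le> K3 * real n powr (2/3)" if n: "n \<ge> 1" for n
  proof -
    have "real n * q n \<le> real n * (d' * real n powr (-1/3))"
      using d(4)[OF n] by (intro mult_left_mono) auto
    also have "\<dots> = d' * (real n powr 1 * real n powr (-1/3))" using n by simp
    also have "\<dots> = d' * real n powr (2/3)" by (simp only: powr_add[symmetric]) simp
    finally show ?thesis using c(4)[OF n] by (simp add: K3_def algebra_simps)
  qed
  show ?thesis
  proof (intro exI conjI allI impI)
    show "0 < 1 + K3 + 1200 * K3 * (3 + 2 * K1 + 2 * K2)" using K by (simp add: add_pos_pos)
    have "3 * (3 + K1) * D\<^sup>2 + 1 > 0" using K by (simp add: add_nonneg_pos)
    thus "0 < 1 / (3 * (3 + K1) * D\<^sup>2 + 1)" by simp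
    fix p n G L \<sigma> xs x0
    assume problem: "vfkm_problem p n G L \<sigma> xs" and x0: "x0 \<in> Rspace p" "vnorm p (x0 - xs) = D"
    hence n: "n \<ge> 1" by (simp add: vfkm_problem_def)
    interpret snapshot_method p n G L \<sigma> xs "b n" "svrg_rho (q n)" "3 * real (b n) + real n * q n"
      "\<lambda>x' w. map_pmf (\<lambda>u. (if u then x' else w, 3 * b n + (if u then n else 0))) (bernoulli_pmf (q n))"
      "\<lambda>w i. G i w" "Rspace p" "svrg_estimator n G (\<lambda>_. 1/2) (b n) (q n)"
      using svrg_snapshot_method[OF problem] range n by blast
    note constants = svrg_constants[OF n _ _ _ c(1) d(1) c(3)[OF n] d(3)[OF n], folded K1_def K2_def]
    show "let \<kappa> = L / \<sigma>; \<rho> = svrg_rho (q n); T = svrg_T (b n) (q n); T' = svrg_T' (b n) (q n);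
                \<beta> = beta_bar \<rho> T T' \<sigma> \<kappa> / 2;
                X = vfkm (\<lambda>_. 1/3) (\<lambda>_. 4 * \<beta> / 3)
                      (svrg_estimator n G (\<lambda>_. 1/2) (b n) (q n)) x0 x0
            in (N_const \<rho> T T' \<kappa>)\<^sup>2 + 12 * \<rho> * M_const \<rho> T T' \<kappa> \<ge> 0 \<longrightarrow> 2 * \<rho> < 1 \<longrightarrow>
               (\<forall>\<epsilon>. 0 < \<epsilon> \<and> \<epsilon> < 1 / (3 * (3 + K1) * D\<^sup>2 + 1) \<longrightarrow>
                  (\<exists>k. expected_sq_error p xs (X k) \<le> \<epsilon>\<^sup>2 \<and>
                       expected_evals (X k)
                         \<le> (1 + K3 + 1200 * K3 * (3 + 2 * K1 + 2 * K2)) *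
                           (real n + max (real n) (real n powr (2/3) * \<kappa>) * ln (1 / \<epsilon>))))"
      unfolding Let_def
    proof (intro impI allI, elim conjE, rule complexity)
      show "1 / real (b n) \<le> svrg_T (b n) (q n) + svrg_T' (b n) (q n)"
        "svrg_T (b n) (q n) + svrg_T' (b n) (q n) \<le> K1 * svrg_rho (q n)"
        "1 / svrg_rho (q n) \<le> K2 * real n powr (1/3)"
        using constants range n by blast+
    qed (use x0 K cost[OF n] in auto)
  qed
qed

lemma saga_complexity:
  fixes b :: "nat \<Rightarrow> nat" and D :: real
  assumes range: "\<forall>n\<ge>1. b n \<ge> 1 \<and> b n \<le> n"
    and b_order: "(\<lambda>n. real (b n)) \<in> \<Theta>(\<lambda>n. real n powr (2/3))"
  shows "\<exists>C>0. \<exists>\<epsilon>0>0. \<forall>p n G L \<sigma> xs x0.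
           vfkm_problem p n G L \<sigma> xs \<longrightarrow> x0 \<in> Rspace p \<longrightarrow> vnorm p (x0 - xs) = D \<longrightarrow>
           (let \<kappa> = L / \<sigma>; \<rho> = saga_rho n (b n); T = saga_T n (b n); T' = saga_T' n (b n);
                \<beta> = beta_bar \<rho> T T' \<sigma> \<kappa> / 2;
                X = vfkm (\<lambda>_. 1/3) (\<lambda>_. 4 * \<beta> / 3)
                      (saga_estimator n G (\<lambda>_. 1/2) (b n)) x0 (\<lambda>i. G i x0)
            in (N_const \<rho> T T' \<kappa>)\<^sup>2 + 12 * \<rho> * M_const \<rho> T T' \<kappa> \<ge> 0 \<longrightarrow> 2 * \<rho> < 1 \<longrightarrow>
               (\<forall>\<epsilon>. 0 < \<epsilon> \<and> \<epsilon> < \<epsilon>0 \<longrightarrow>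
                  (\<exists>k. expected_sq_error p xs (X k) \<le> \<epsilon>\<^sup>2 \<and>
                       expected_evals (X k)
                         \<le> C * (real n + max (real n) (real n powr (2/3) * \<kappa>) * ln (1 / \<epsilon>)))))"
proof -
  have b_pos: "0 < real (b n)" if "n \<ge> 1" for n
    using range that by fastforce
  obtain c c' where c: "c > 0" "c' > 0" "\<And>n. n \<ge> 1 \<Longrightarrow> c * real n powr (2/3) \<le> real (b n)"
      "\<And>n. n \<ge> 1 \<Longrightarrow> real (b n) \<le> c' * real n powr (2/3)"
    using bigtheta_bounds_everywhere[OF b_order] b_pos by blast
  define K1 K2 K3 where "K1 = 26 / c ^ 3" and "K2 = 2 / c" and "K3 = 3 * c'"
  have K: "K1 > 0" "K2 > 0" "K3 > 0" using c by (auto simp: K1_def K2_def K3_def)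
  have cost: "3 * real (b n) \<le> K3 * real n powr (2/3)" if n: "n \<ge> 1" for n
    using c(4)[OF n] by (simp add: K3_def)
  show ?thesis
  proof (intro exI conjI allI impI)
    show "0 < 1 + K3 + 1200 * K3 * (3 + 2 * K1 + 2 * K2)" using K by (simp add: add_pos_pos)
    have "3 * (3 + K1) * D\<^sup>2 + 1 > 0" using K by (simp add: add_nonneg_pos)
    thus "0 < 1 / (3 * (3 + K1) * D\<^sup>2 + 1)" by simp
    fix p n G L \<sigma> xs x0
    assume problem: "vfkm_problem p n G L \<sigma> xs" and x0: "x0 \<in> Rspace p" "vnorm p (x0 - xs) = D"
    hence n: "n \<ge> 1" by (simp add: vfkm_problem_def)
    note constants = saga_constants[OF _ _ c(1) c(3)[OF n], folded K1_def K2_def]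
    show "let \<kappa> = L / \<sigma>; \<rho> = saga_rho n (b n); T = saga_T n (b n); T' = saga_T' n (b n);
                \<beta> = beta_bar \<rho> T T' \<sigma> \<kappa> / 2;
                X = vfkm (\<lambda>_. 1/3) (\<lambda>_. 4 * \<beta> / 3)
                      (saga_estimator n G (\<lambda>_. 1/2) (b n)) x0 (\<lambda>i. G i x0)
            in (N_const \<rho> T T' \<kappa>)\<^sup>2 + 12 * \<rho> * M_const \<rho> T T' \<kappa> \<ge> 0 \<longrightarrow> 2 * \<rho> < 1 \<longrightarrow>
               (\<forall>\<epsilon>. 0 < \<epsilon> \<and> \<epsilon> < 1 / (3 * (3 + K1) * D\<^sup>2 + 1) \<longrightarrow>
                  (\<exists>k. expected_sq_error p xs (X k) \<le> \<epsilon>\<^sup>2 \<and>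
                       expected_evals (X k)
                         \<le> (1 + K3 + 1200 * K3 * (3 + 2 * K1 + 2 * K2)) *
                           (real n + max (real n) (real n powr (2/3) * \<kappa>) * ln (1 / \<epsilon>))))"
      unfolding Let_def
    proof (intro impI allI, elim conjE)
      fix \<epsilon> :: real
      assume discr: "0 \<le> (N_const (saga_rho n (b n)) (saga_T n (b n)) (saga_T' n (b n)) (L / \<sigma>))\<^sup>2
          + 12 * saga_rho n (b n) * M_const (saga_rho n (b n)) (saga_T n (b n)) (saga_T' n (b n)) (L / \<sigma>)"
        and rho: "2 * saga_rho n (b n) < 1" and eps: "0 < \<epsilon>" "\<epsilon> < 1 / (3 * (3 + K1) * D\<^sup>2 + 1)"
      have "b n < n" using rho n by (simp add: saga_rho_def)
      interpret snapshot_method p n G L \<sigma> xs "b n" "saga_rho n (b n)" "3 * real (b n)"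
        "\<lambda>x' H. map_pmf (\<lambda>A. (\<lambda>i. if i \<in> A then G i x' else H i, 3 * b n))
           (pmf_of_set {A. A \<subseteq> {1..n} \<and> card A = b n})"
        "\<lambda>H. H" "{H. \<forall>i\<in>{1..n}. H i \<in> Rspace p}" "saga_estimator n G (\<lambda>_. 1/2) (b n)"
        using saga_snapshot_method[OF problem _ \<open>b n < n\<close>] range n by blast
      have closed: "(\<lambda>i. G i x0) \<in> {H. \<forall>i\<in>{1..n}. H i \<in> Rspace p}"
        using G_closed x0(1) by blast
      have constants: "1 / real (b n) \<le> saga_T n (b n) + saga_T' n (b n)"
        "saga_T n (b n) + saga_T' n (b n) \<le> K1 * saga_rho n (b n)"
        "1 / saga_rho n (b n) \<le> K2 * real n powr (1/3)"
        using constants range n by blast+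
      show "\<exists>k. expected_sq_error p xs (vfkm (\<lambda>_. 1/3) (\<lambda>_. 4 * (beta_bar (saga_rho n (b n))
                (saga_T n (b n)) (saga_T' n (b n)) \<sigma> (L / \<sigma>) / 2) / 3)
                (saga_estimator n G (\<lambda>_. 1/2) (b n)) x0 (\<lambda>i. G i x0) k) \<le> \<epsilon>\<^sup>2 \<and>
            expected_evals (vfkm (\<lambda>_. 1/3) (\<lambda>_. 4 * (beta_bar (saga_rho n (b n))
                (saga_T n (b n)) (saga_T' n (b n)) \<sigma> (L / \<sigma>) / 2) / 3)
                (saga_estimator n G (\<lambda>_. 1/2) (b n)) x0 (\<lambda>i. G i x0) k)
              \<le> (1 + K3 + 1200 * K3 * (3 + 2 * K1 + 2 * K2)) *
                 (real n + max (real n) (real n powr (2/3) * (L / \<sigma>)) * ln (1 / \<epsilon>))"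
        using complexity[OF x0(1) closed refl x0(2) constants cost[OF n] less_imp_le[OF K(3)] discr eps] .
    qed
  qed
qed

theorem corollary3:
  shows
    "(\<forall>(b :: nat \<Rightarrow> nat) (q :: nat \<Rightarrow> real).
        (\<forall>n\<ge>1. b n \<ge> 1 \<and> 0 < q n \<and> q n < 1) \<longrightarrow>
        (\<lambda>n. real (b n)) \<in> \<Theta>(\<lambda>n. real n powr (2/3)) \<longrightarrow>
        q \<in> \<Theta>(\<lambda>n. real n powr (-1/3)) \<longrightarrow>
        (\<forall>D. \<exists>C>0. \<exists>\<epsilon>0>0. \<forall>p n G L \<sigma> xs x0.
           vfkm_problem p n G L \<sigma> xs \<longrightarrow> x0 \<in> Rspace p \<longrightarrow> vnorm p (x0 - xs) = D \<longrightarrow>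
           (let \<kappa> = L / \<sigma>; \<rho> = svrg_rho (q n); T = svrg_T (b n) (q n); T' = svrg_T' (b n) (q n);
                \<beta> = beta_bar \<rho> T T' \<sigma> \<kappa> / 2;
                X = vfkm (\<lambda>_. 1/3) (\<lambda>_. 4 * \<beta> / 3)
                      (svrg_estimator n G (\<lambda>_. 1/2) (b n) (q n)) x0 x0
            in (N_const \<rho> T T' \<kappa>)\<^sup>2 + 12 * \<rho> * M_const \<rho> T T' \<kappa> \<ge> 0 \<longrightarrow> 2 * \<rho> < 1 \<longrightarrow>
               (\<forall>\<epsilon>. 0 < \<epsilon> \<and> \<epsilon> < \<epsilon>0 \<longrightarrow>
                  (\<exists>k. expected_sq_error p xs (X k) \<le> \<epsilon>\<^sup>2 \<and>
                       expected_evals (X k)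
                         \<le> C * (real n + max (real n) (real n powr (2/3) * \<kappa>) * ln (1 / \<epsilon>)))))))
     \<and>
     (\<forall>b :: nat \<Rightarrow> nat.
        (\<forall>n\<ge>1. b n \<ge> 1 \<and> b n \<le> n) \<longrightarrow>
        (\<lambda>n. real (b n)) \<in> \<Theta>(\<lambda>n. real n powr (2/3)) \<longrightarrow>
        (\<forall>D. \<exists>C>0. \<exists>\<epsilon>0>0. \<forall>p n G L \<sigma> xs x0.
           vfkm_problem p n G L \<sigma> xs \<longrightarrow> x0 \<in> Rspace p \<longrightarrow> vnorm p (x0 - xs) = D \<longrightarrow>
           (let \<kappa> = L / \<sigma>; \<rho> = saga_rho n (b n); T = saga_T n (b n); T' = saga_T' n (b n);
                \<beta> = beta_bar \<rho> T T' \<sigma> \<kappa> / 2;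
                X = vfkm (\<lambda>_. 1/3) (\<lambda>_. 4 * \<beta> / 3)
                      (saga_estimator n G (\<lambda>_. 1/2) (b n)) x0 (\<lambda>i. G i x0)
            in (N_const \<rho> T T' \<kappa>)\<^sup>2 + 12 * \<rho> * M_const \<rho> T T' \<kappa> \<ge> 0 \<longrightarrow> 2 * \<rho> < 1 \<longrightarrow>
               (\<forall>\<epsilon>. 0 < \<epsilon> \<and> \<epsilon> < \<epsilon>0 \<longrightarrow>
                  (\<exists>k. expected_sq_error p xs (X k) \<le> \<epsilon>\<^sup>2 \<and>
                       expected_evals (X k)
                         \<le> C * (real n + max (real n) (real n powr (2/3) * \<kappa>) * ln (1 / \<epsilon>)))))))"
  by (rule conjI; intro allI impI) (rule svrg_complexity saga_complexity; assumption)+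

end
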